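(* Let $L\ge m>0$, and consider the projected algorithm $$x_{k+\frac12}=\mathbf A x_k+\mathbf B\nabla f(y_k),\qquad y_k=\begin{bmatrix}\tilde C&0\end{bmatrix}x_k,\qquad x_{k+1}=\Pi^{\mathbf P}_{\mathcal D}(x_{k+\frac12}),$$ with $\mathbf A,\mathbf B,\tilde C,\mathbf P,\mathcal D$ as described in the context. Assume that for any $f\in S(m,L)$ and any closed convex set $\Omega\subseteq\mathbb{R}^d$ this algorithm admits a unique fixed point $x_*=(y_*,\mathbf y_*,\eta_* )$, i.e. a unique $x_*$ with $x_*=\Pi^{\mathbf P}_{\mathcal D}\big(\mathbf A x_*+\mathbf B\nabla f(y_* )\big)$. Then $y_*$ is the unique optimal solution of the problem $\min_{y\in\Omega}f(y)$.
   Context: Function class: $S(m,L)$ is the set of differentiable $f:\mathbb{R}^d\to\mathbb{R}$ with $m\|x-y\|_2^2\le(\nabla f(x)-\nabla f(y))^\top(x-y)\le L\|x-y\|_2^2$ for all $x,y\in\mathbb{R}^d$. The set $\Omega\subseteq\mathbb{R}^d$ is nonempty, closed and convex. Unconstrained algorithm in canonical structure, of relative degree $r\ge1$: the state is $\tilde\xi_k=(\tilde\xi^{(1)}_k,\tilde\xi^{(2)}_k)\in\mathbb{R}^{nd}$ with $\tilde\xi^{(1)}_k=(y_{k+r-1},\dots,y_k)\in\mathbb{R}^{rd}$, and $\tilde\xi_{k+1}=\tilde A\tilde\xi_k+\tilde Bu_k$, $y_k=\tilde C\tilde\xi_k$, $u_k=\nabla f(y_k)$. Here $\tilde A=\begin{bmatrix}\tilde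 A_{11}&\tilde A_{12}\\ \tilde A_{21}&\tilde A_{22}\end{bmatrix}$. The block $\tilde A_{11}\in\mathbb{R}^{rd\times rd}$ has an arbitrary first block row and the block-shift rows $[I_d\ 0\cdots0],\dots,[0\cdots I_d\ 0]$ below it. The block $\tilde A_{12}\in\mathbb{R}^{rd\times(n-r)d}$ has an arbitrary first block row and zeros below. The blocks $\tilde A_{21},\tilde A_{22}$ are arbitrary. Further, $\tilde B=\begin{bmatrix}gI_d\\ 0\end{bmatrix}$ with $g<0$, and $\tilde C=\begin{bmatrix}0_{d\times(r-1)d}&I_d&0_{d\times(n-r)d}\end{bmatrix}$. All system matrices, and the matrix $\mathbf P$ below, have the Kronecker form $(\cdot)\otimes I_d$. Standing assumptions: $(\tilde A,\tilde C)$ is detectable, $\tilde A$ has an eigenvalue at $1$, and for each $y_*\in\mathbb{R}^d$ there is a unique $\tilde\xi_*$ with $\tilde A\tilde\xi_*=\tilde\xi_*$, $\tilde C\tilde\xi_*=y_*$. Augmented system: for a lifting integer $\ell\in\mathbb{N}$, the filter state $\zeta_k\in\mathbb{R}^{2\ell d}$ obeys $\zeta_{k+1}=A_\zeta\zeta_k+B^y_\zeta y_k+B^u_\zeta u_k$, $z_k=C_\zeta\zeta_k+D^y_\zeta y_k+D^u_\zeta u_k$. Here $A_\zeta=\operatorname{blkdiag}(A_0,A_0)$ with $A_0\in\mathbb{R}^{\ell d\times\ell d}$ the block down-shift ($I_d$ on the first block subdiagonal, zeros elsewhere); $[B^y_\zeta\ B^u_\zeta]=\operatorname{blkdiag}(B_0,B_0)$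 with $B_0=\begin{bmatrix}I_d\\ 0_{(\ell-1)d\times d}\end{bmatrix}$; $C_\zeta=\operatorname{blkdiag}(C_0,C_0)$ with $C_0=\begin{bmatrix}0_{d\times\ell d}\\ I_{\ell d}\end{bmatrix}$; $[D^y_\zeta\ D^u_\zeta]=\operatorname{blkdiag}(D_0,D_0)$ with $D_0=\begin{bmatrix}I_d\\ 0_{\ell d\times d}\end{bmatrix}$. Thus $z_k=(y_k,\dots,y_{k-\ell},u_k,\dots,u_{k-\ell})$ is the lifted signal. With $x_k=(\tilde\xi_k,\zeta_k)\in\mathbb{R}^{(n+2\ell)d}$ the augmented system is $x_{k+1}=\mathbf Ax_k+\mathbf Bu_k$, $z_k=\mathbf Cx_k+\mathbf Du_k$, where $$\mathbf A=\begin{bmatrix}\tilde A&0\\ B^y_\zeta\tilde C&A_\zeta\end{bmatrix},\quad \mathbf B=\begin{bmatrix}\tilde B\\ B^u_\zeta\end{bmatrix},\quad \mathbf C=\begin{bmatrix}D^y_\zeta\tilde C&C_\zeta\end{bmatrix},\quad \mathbf D=D^u_\zeta.$$ Lyapunov matrix: $\mathbf P\succ0$ is a matrix such that, for some $\rho\in(0,1)$ and some $Q,\tilde Q\in\mathcal Q$, the LMI $$\begin{bmatrix}\mathbf A^\top\mathbf P\mathbf A-\rho^2\mathbf P&\mathbf A^\top\mathbf P\mathbf B\\ \mathbf B^\top\mathbf P\mathbf A&\mathbf B^\top\mathbf P\mathbf B\end{bmatrix}+\begin{bmatrix}\mathbf C^\top\\ \mathbf D^\top\end{bmatrix}\mathbf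 M\begin{bmatrix}\mathbf C&\mathbf D\end{bmatrix}\preceq0$$ holds (the existence of such $\ell,\mathbf P,\rho,Q,\tilde Q$ is assumed). Here $\mathcal Q$ is the set of $Q\in\mathbb{R}^{(\ell+1)\times(\ell+1)}$ with $Q_{ij}\le0$ for $i\ne j$, $Q\mathbf 1\ge0$, $Q^\top\mathbf 1\ge0$, and $$\mathbf M=\Big(\mathcal T^\top\begin{bmatrix}0&Q^\top\\ Q&0\end{bmatrix}\mathcal T\Big)\otimes I_d+\Big(\mathcal T^\top\begin{bmatrix}0&(T_\rho\tilde QT_\rho)^\top\\ T_\rho\tilde QT_\rho&0\end{bmatrix}\mathcal T\Big)\otimes I_d,$$ with $\mathcal T=\begin{bmatrix}L&-1\\ -m&1\end{bmatrix}\otimes I_{\ell+1}$ and $T_\rho=\operatorname{diag}(1,\rho,\dots,\rho^\ell)$. Projection: the augmented state is partitioned as $x_k=(y_{k+r-1},\mathbf y_k,\eta_k)$ with $\mathbf y_k=(y_{k+r-2},\dots,y_k)\in\mathbb{R}^{(r-1)d}$ and $\eta_k=(\tilde\xi^{(2)}_k,\zeta_k)\in\mathbb{R}^{(n+2\ell-r)d}$. With respect to this partition, $\mathbf A_{r1}$ and $\mathbf A_{rr}$ denote the (second, first) and (second, second) blocks of $\mathbf A$. Set $$\mathcal D=\mathcal Y\times\mathbb{R}^{(n+2\ell-r)d},\qquad \mathcal Y=\{(\xi^{(1)},\xi^{(2)})\in\mathbb{R}^{d}\times\mathbb{R}^{(r-1)d}:\ \xi^{(1)}\in\Omega,\ \mathbf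 A_{r1}\xi^{(1)}=(I-\mathbf A_{rr})\xi^{(2)}\}$$ (for $r=1$, $\mathcal Y=\Omega$). Finally $\Pi^{\mathbf P}_{\mathcal D}(x)=\operatorname{argmin}_{v\in\mathcal D}(x-v)^\top\mathbf P(x-v)$. *)

theory Defs
  imports "HOL-Analysis.Analysis" "Jordan_Normal_Form.Matrix"
begin

hide_const (open) Finite_Cartesian_Product.vec Finite_Cartesian_Product.mat
hide_type (open) Finite_Cartesian_Product.vec

definition grad :: "('v::real_inner \<Rightarrow> real) \<Rightarrow> 'v \<Rightarrow> 'v" where
  "grad f x = (THE D. GDERIV f x :> D)"

definition S_class :: "real \<Rightarrow> real \<Rightarrow> ('v::euclidean_space \<Rightarrow> real) set" where
  "S_class m L = {f. (\<forall>x. f differentiable (at x)) \<and>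
     (\<forall>x y. m * (norm (x - y))\<^sup>2 \<le> inner (grad f x - grad f y) (x - y) \<and>
            inner (grad f x - grad f y) (x - y) \<le> L * (norm (x - y))\<^sup>2)}"

text \<open>
  With \<open>'v\<close> in the role of \<open>\<real>\<^sup>d\<close>, an element of \<open>\<real>\<^sup>N\<^sup>d\<close> is a block vector
  \<open>x :: 'v vec\<close> in \<open>carrier_vec N\<close>, whose entries are its \<open>d\<close>-dimensional blocks.
  A matrix of the form \<open>X \<otimes> I\<^sub>d\<close> is represented by the real matrix \<open>X\<close>, together with its
  action on block vectors. Sums, products, transposes and block compositions of such matrices
  are again of this form, and are the corresponding operations on the left factors.
  Definiteness of \<open>X \<otimes> I\<^sub>d\<close> is stated with the quadratic form on all of \<open>\<real>\<^sup>N\<^sup>d\<close>; the argument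
  of type \<open>'v itself\<close> fixes \<open>\<real>\<^sup>d\<close>.
\<close>

definition kron_mult_vec :: "real mat \<Rightarrow> 'v::real_vector vec \<Rightarrow> 'v vec" (infixr \<open>*\<^sub>k\<close> 70) where
  "X *\<^sub>k x = Matrix.vec (dim_row X) (\<lambda>i. \<Sum>j<dim_col X. X $$ (i, j) *\<^sub>R vec_index x j)"

definition kron_quad :: "real mat \<Rightarrow> 'v::real_inner vec \<Rightarrow> real" where
  "kron_quad X x = (\<Sum>i<dim_vec x. inner (vec_index x i) (vec_index (X *\<^sub>k x) i))"

definition kron_pos_def :: "'v::real_inner itself \<Rightarrow> real mat \<Rightarrow> bool" where
  "kron_pos_def _ X \<longleftrightarrow> square_mat X \<and> transpose_mat X = X \<and>
     (\<forall>x::'v vec. x \<in> carrier_vec (dim_row X) \<and> x \<noteq> 0\<^sub>v (dim_row X) \<longrightarrow> 0 < kron_quad X x)"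

definition kron_neg_semidef :: "'v::real_inner itself \<Rightarrow> real mat \<Rightarrow> bool" where
  "kron_neg_semidef _ X \<longleftrightarrow> square_mat X \<and> transpose_mat X = X \<and>
     (\<forall>x::'v vec. x \<in> carrier_vec (dim_row X) \<longrightarrow> kron_quad X x \<le> 0)"

abbreviation single_block :: "'v \<Rightarrow> 'v vec" where
  "single_block u \<equiv> Matrix.vec 1 (\<lambda>_. u)"

definition append_cols :: "'a::zero mat \<Rightarrow> 'a mat \<Rightarrow> 'a mat" (infixr \<open>@\<^sub>c\<close> 65) where
  "X @\<^sub>c Y = four_block_mat X Y (0\<^sub>m 0 (dim_col X)) (0\<^sub>m 0 (dim_col Y))"

text \<open>
  Only the rows \<open>1, \<dots>, r - 1\<close> (counted from 0) of the state matrix are prescribed: they are the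
  shift rows of the blocks \<open>A\<^sub>1\<^sub>1\<close> and \<open>A\<^sub>1\<^sub>2\<close>.
\<close>

definition canonical_A :: "nat \<Rightarrow> nat \<Rightarrow> real mat \<Rightarrow> bool" where
  "canonical_A n r At \<longleftrightarrow> At \<in> carrier_mat n n \<and>
     (\<forall>i\<in>{1..<r}. \<forall>j<n. At $$ (i, j) = (if j = i - 1 then 1 else 0))"

definition canonical_B :: "nat \<Rightarrow> real \<Rightarrow> real mat" where
  "canonical_B n g = Matrix.mat n 1 (\<lambda>(i, _). if i = 0 then g else 0)"

definition canonical_C :: "nat \<Rightarrow> nat \<Rightarrow> real mat" where
  "canonical_C n r = Matrix.mat 1 n (\<lambda>(_, j). if j = r - 1 then 1 else 0)"

text \<open>Detectability in the time domain, i.e. all unobservable modes of the pair are Schur stable.\<close>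

definition detectable :: "'v::real_normed_vector itself \<Rightarrow> real mat \<Rightarrow> real mat \<Rightarrow> bool" where
  "detectable _ X C \<longleftrightarrow> (\<forall>\<xi>::nat \<Rightarrow> 'v vec.
     \<xi> 0 \<in> carrier_vec (dim_row X) \<and> (\<forall>k. \<xi> (Suc k) = X *\<^sub>k \<xi> k) \<and>
     (\<forall>k. C *\<^sub>k \<xi> k = 0\<^sub>v (dim_row C)) \<longrightarrow>
     (\<forall>i<dim_row X. (\<lambda>k. vec_index (\<xi> k) i) \<longlonglongrightarrow> 0))"

definition eigenvalue_one :: "'v::real_vector itself \<Rightarrow> real mat \<Rightarrow> bool" where
  "eigenvalue_one _ X \<longleftrightarrow> (\<exists>\<xi>::'v vec.
     \<xi> \<in> carrier_vec (dim_row X) \<and> \<xi> \<noteq> 0\<^sub>v (dim_row X) \<and> X *\<^sub>k \<xi> = \<xi>)"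

definition filt_A0 :: "nat \<Rightarrow> real mat" where
  "filt_A0 l = Matrix.mat l l (\<lambda>(i, j). if i = j + 1 then 1 else 0)"

definition filt_B0 :: "nat \<Rightarrow> real mat" where
  "filt_B0 l = Matrix.mat l 1 (\<lambda>(i, _). if i = 0 then 1 else 0)"

definition filt_C0 :: "nat \<Rightarrow> real mat" where
  "filt_C0 l = 0\<^sub>m 1 l @\<^sub>r 1\<^sub>m l"

definition filt_D0 :: "nat \<Rightarrow> real mat" where
  "filt_D0 l = 1\<^sub>m 1 @\<^sub>r 0\<^sub>m l 1"

definition filt_A :: "nat \<Rightarrow> real mat" where
  "filt_A l = four_block_mat (filt_A0 l) (0\<^sub>m l l) (0\<^sub>m l l) (filt_A0 l)"

definition filt_By :: "nat \<Rightarrow> real mat" where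
  "filt_By l = filt_B0 l @\<^sub>r 0\<^sub>m l 1"

definition filt_Bu :: "nat \<Rightarrow> real mat" where
  "filt_Bu l = 0\<^sub>m l 1 @\<^sub>r filt_B0 l"

definition filt_C :: "nat \<Rightarrow> real mat" where
  "filt_C l = four_block_mat (filt_C0 l) (0\<^sub>m (l + 1) l) (0\<^sub>m (l + 1) l) (filt_C0 l)"

definition filt_Dy :: "nat \<Rightarrow> real mat" where
  "filt_Dy l = filt_D0 l @\<^sub>r 0\<^sub>m (l + 1) 1"

definition filt_Du :: "nat \<Rightarrow> real mat" where
  "filt_Du l = 0\<^sub>m (l + 1) 1 @\<^sub>r filt_D0 l"

definition aug_A :: "nat \<Rightarrow> nat \<Rightarrow> nat \<Rightarrow> real mat \<Rightarrow> real mat" where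
  "aug_A n r l At =
     four_block_mat At (0\<^sub>m n (2 * l)) (filt_By l * canonical_C n r) (filt_A l)"

definition aug_B :: "nat \<Rightarrow> nat \<Rightarrow> real \<Rightarrow> real mat" where
  "aug_B n l g = canonical_B n g @\<^sub>r filt_Bu l"

definition aug_C :: "nat \<Rightarrow> nat \<Rightarrow> nat \<Rightarrow> real mat" where
  "aug_C n r l = (filt_Dy l * canonical_C n r) @\<^sub>c filt_C l"

definition aug_D :: "nat \<Rightarrow> real mat" where
  "aug_D l = filt_Du l"

definition Q_class :: "nat \<Rightarrow> real mat set" where
  "Q_class l = {Q \<in> carrier_mat (l + 1) (l + 1).
     (\<forall>i<l + 1. \<forall>j<l + 1. i \<noteq> j \<longrightarrow> Q $$ (i, j) \<le> 0) \<and>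
     (\<forall>i<l + 1. 0 \<le> (\<Sum>j<l + 1. Q $$ (i, j))) \<and>
     (\<forall>j<l + 1. 0 \<le> (\<Sum>i<l + 1. Q $$ (i, j)))}"

definition sector_T :: "real \<Rightarrow> real \<Rightarrow> nat \<Rightarrow> real mat" where
  "sector_T m L l = four_block_mat
     (L \<cdot>\<^sub>m 1\<^sub>m (l + 1)) ((-1) \<cdot>\<^sub>m 1\<^sub>m (l + 1))
     ((-m) \<cdot>\<^sub>m 1\<^sub>m (l + 1)) (1\<^sub>m (l + 1))"

definition rho_T :: "real \<Rightarrow> nat \<Rightarrow> real mat" where
  "rho_T \<rho> l = mat_diag (l + 1) (\<lambda>i. \<rho> ^ i)"

definition anti_diag :: "nat \<Rightarrow> real mat \<Rightarrow> real mat" where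
  "anti_diag l Q = four_block_mat
     (0\<^sub>m (l + 1) (l + 1)) (transpose_mat Q) Q (0\<^sub>m (l + 1) (l + 1))"

definition multiplier_M :: "real \<Rightarrow> real \<Rightarrow> nat \<Rightarrow> real \<Rightarrow> real mat \<Rightarrow> real mat \<Rightarrow> real mat" where
  "multiplier_M m L l \<rho> Q Qt =
     transpose_mat (sector_T m L l) * anti_diag l Q * sector_T m L l +
     transpose_mat (sector_T m L l) * anti_diag l (rho_T \<rho> l * Qt * rho_T \<rho> l) * sector_T m L l"

definition LMI_matrix ::
    "real mat \<Rightarrow> real mat \<Rightarrow> real mat \<Rightarrow> real mat \<Rightarrow> real mat \<Rightarrow> real \<Rightarrow> real mat \<Rightarrow> real mat" where
  "LMI_matrix A B C D P \<rho> M =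
     four_block_mat
       (transpose_mat A * P * A - \<rho>\<^sup>2 \<cdot>\<^sub>m P) (transpose_mat A * P * B)
       (transpose_mat B * P * A) (transpose_mat B * P * B) +
     transpose_mat (C @\<^sub>c D) * M * (C @\<^sub>c D)"

definition lyapunov_matrix ::
    "'v::real_inner itself \<Rightarrow> real \<Rightarrow> real \<Rightarrow> nat \<Rightarrow> nat \<Rightarrow> nat \<Rightarrow> real mat \<Rightarrow> real \<Rightarrow> real mat \<Rightarrow> bool" where
  "lyapunov_matrix V m L n r l At g P \<longleftrightarrow>
     P \<in> carrier_mat (n + 2 * l) (n + 2 * l) \<and> kron_pos_def V P \<and>
     (\<exists>\<rho> Q Qt. 0 < \<rho> \<and> \<rho> < 1 \<and> Q \<in> Q_class l \<and> Qt \<in> Q_class l \<and>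
        kron_neg_semidef V
          (LMI_matrix (aug_A n r l At) (aug_B n l g) (aug_C n r l) (aug_D l) P \<rho>
             (multiplier_M m L l \<rho> Q Qt)))"

definition part_A_r1 :: "nat \<Rightarrow> real mat \<Rightarrow> real mat" where
  "part_A_r1 r A = Matrix.mat (r - 1) 1 (\<lambda>(i, j). A $$ (i + 1, j))"

definition part_A_rr :: "nat \<Rightarrow> real mat \<Rightarrow> real mat" where
  "part_A_rr r A = Matrix.mat (r - 1) (r - 1) (\<lambda>(i, j). A $$ (i + 1, j + 1))"

definition Y_set :: "nat \<Rightarrow> real mat \<Rightarrow> 'v::real_vector set \<Rightarrow> ('v \<times> 'v vec) set" where
  "Y_set r A \<Omega> = {(\<xi>1, \<xi>2). \<xi>2 \<in> carrier_vec (r - 1) \<and> \<xi>1 \<in> \<Omega> \<and>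
     part_A_r1 r A *\<^sub>k single_block \<xi>1 = (1\<^sub>m (r - 1) - part_A_rr r A) *\<^sub>k \<xi>2}"

text \<open>The augmented state \<open>(y\<^sub>k\<^sub>+\<^sub>r\<^sub>-\<^sub>1, \<^bold>y\<^sub>k, \<eta>\<^sub>k)\<close> is \<open>vCons y (yb @\<^sub>v \<eta>)\<close>.\<close>

definition D_set :: "nat \<Rightarrow> nat \<Rightarrow> nat \<Rightarrow> real mat \<Rightarrow> 'v::real_vector set \<Rightarrow> 'v vec set" where
  "D_set n r l A \<Omega> = {vCons \<xi>1 (\<xi>2 @\<^sub>v \<eta>) | \<xi>1 \<xi>2 \<eta>.
     (\<xi>1, \<xi>2) \<in> Y_set r A \<Omega> \<and> \<eta> \<in> carrier_vec (n + 2 * l - r)}"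

definition proj :: "real mat \<Rightarrow> 'v::real_inner vec set \<Rightarrow> 'v vec \<Rightarrow> 'v vec" where
  "proj P S x = arg_min_on (\<lambda>v. kron_quad P (x - v)) S"

definition alg_output :: "nat \<Rightarrow> nat \<Rightarrow> nat \<Rightarrow> 'v::real_vector vec \<Rightarrow> 'v" where
  "alg_output n r l x = vec_index ((canonical_C n r @\<^sub>c 0\<^sub>m 1 (2 * l)) *\<^sub>k x) 0"

definition proj_step ::
    "nat \<Rightarrow> nat \<Rightarrow> nat \<Rightarrow> real mat \<Rightarrow> real \<Rightarrow> real mat \<Rightarrow> ('v::euclidean_space \<Rightarrow> real) \<Rightarrow> 'v set
     \<Rightarrow> 'v vec \<Rightarrow> 'v vec" where
  "proj_step n r l At g P f \<Omega> x =
     proj P (D_set n r l (aug_A n r l At) \<Omega>)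
       (aug_A n r l At *\<^sub>k x + aug_B n l g *\<^sub>k single_block (grad f (alg_output n r l x)))"

definition fixed_point ::
    "nat \<Rightarrow> nat \<Rightarrow> nat \<Rightarrow> real mat \<Rightarrow> real \<Rightarrow> real mat \<Rightarrow> ('v::euclidean_space \<Rightarrow> real) \<Rightarrow> 'v set
     \<Rightarrow> 'v vec \<Rightarrow> bool" where
  "fixed_point n r l At g P f \<Omega> x \<longleftrightarrow>
     x \<in> carrier_vec (n + 2 * l) \<and> x = proj_step n r l At g P f \<Omega> x"

text \<open>
  A fixed point lies in \<open>D_set\<close>, where the first \<open>r\<close> blocks coincide; so the first block of a
  fixed point is also the point at which the gradient is evaluated.
\<close>

lemma alg_output_eq_first_block:
  fixes x :: "'v::real_vector vec"
  assumes A: "canonical_A n r At" and r: "1 \<le> r" "r \<le> n"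
    and x: "x \<in> D_set n r l (aug_A n r l At) \<Omega>"
  shows "alg_output n r l x = vec_index x 0"
proof -
  let ?A = "aug_A n r l At"
  from x obtain a b e where xe: "x = vCons a (b @\<^sub>v e)" and b: "b \<in> carrier_vec (r - 1)"
    and e: "e \<in> carrier_vec (n + 2 * l - r)"
    and eq: "part_A_r1 r ?A *\<^sub>k single_block a = (1\<^sub>m (r - 1) - part_A_rr r ?A) *\<^sub>k b"
    by (auto simp: D_set_def Y_set_def)
  have entry: "?A $$ (Suc i, j) = (if j = i then 1 else 0)" if "i < r - 1" "j < n" for i j
    using A that r by (auto simp: aug_A_def canonical_A_def)
  have step: "vec_index b i = (if i = 0 then a else vec_index b (i - 1))" if i: "i < r - 1" for i
  proof -
    have "vec_index (part_A_r1 r ?A *\<^sub>k single_block a) i = (if i = 0 then a else 0)"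
      using i r entry[of i 0] by (simp add: part_A_r1_def kron_mult_vec_def)
    moreover have "vec_index ((1\<^sub>m (r - 1) - part_A_rr r ?A) *\<^sub>k b) i
      = (\<Sum>j<r - 1. ((if i = j then 1 else 0) - (if Suc j = i then 1 else 0)) *\<^sub>R vec_index b j)"
      using i r by (auto simp: part_A_rr_def kron_mult_vec_def entry intro!: sum.cong)
    moreover have "\<dots> = (\<Sum>j<r - 1. (if i = j then vec_index b j else 0))
        - (\<Sum>j<r - 1. (if j = i - 1 then (if i = 0 then 0 else vec_index b j) else 0))"
      unfolding sum_subtractf[symmetric] by (rule sum.cong) auto
    moreover have "\<dots> = vec_index b i - (if i = 0 then 0 else vec_index b (i - 1))"
      using i by (cases i) (simp_all add: sum.delta)
    ultimately show ?thesis using eq by (auto split: if_splits)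
  qed
  have ball: "vec_index b i = a" if "i < r - 1" for i
    using that by (induction i) (auto simp: step)
  have "vec_index x (r - 1) = a"
    using b r by (cases "r = 1") (auto simp: xe vec_index_vCons ball)
  moreover have "alg_output n r l x = vec_index x (r - 1)"
  proof -
    let ?C = "canonical_C n r @\<^sub>c 0\<^sub>m 1 (2 * l)"
    have dim: "dim_row ?C = 1" "dim_col ?C = n + 2 * l"
      by (simp_all add: append_cols_def canonical_C_def)
    have "?C $$ (0, j) = (if j = r - 1 then 1 else 0)" if "j < n + 2 * l" for j
      using that r by (auto simp: append_cols_def canonical_C_def)
    then have "alg_output n r l x = (\<Sum>j<n + 2 * l. (if j = r - 1 then vec_index x j else 0))"
      unfolding alg_output_def kron_mult_vec_def dim by (simp add: if_distrib[of "\<lambda>c. c *\<^sub>R _"] cong: if_cong)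
    moreover have "r - 1 < n + 2 * l" using r by linarith
    ultimately show ?thesis by simp
  qed
  ultimately show ?thesis by (simp add: xe)
qed

end

theory Submission
  imports Defs
begin

text \<open>
  Let \<open>x\<close> be a state, \<open>u\<close> an input, and \<open>p = P (A x + B u - x)\<close> the displacement of one unprojected
  step, seen in the metric \<open>P\<close>. In the canonical structure the constraint set consists of the states
  whose first \<open>r\<close> blocks coincide and lie in \<open>\<Omega>\<close>, the other blocks being free. Since \<open>P\<close> is positive
  definite, the projection onto this closed convex set exists and is characterized by an obtuse angle.
  Hence (\<open>fixed_point_iff_stationary\<close>) a feasible \<open>x\<close> with output \<open>y\<close> is a fixed point iff, for
  \<open>u = \<nabla>f(y)\<close>, the free blocks of \<open>p\<close> vanish and the sum \<open>q\<close> of the first \<open>r\<close> blocks of \<open>p\<close> satisfies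
  \<open>\<langle>w - y, q\<rangle> \<le> 0\<close> for all \<open>w \<in> \<Omega>\<close>.

  It remains to compare \<open>q\<close> with \<open>\<nabla>f(y)\<close>. The conditions relating \<open>x\<close>, \<open>u\<close> and \<open>q\<close> are linear, have
  the Kronecker form \<open>(\<cdot>) \<otimes> I\<^sub>d\<close>, and do not mention \<open>f\<close> and \<open>\<Omega>\<close>. So the assumed uniqueness
  of fixed points, which holds for all functions of the class and all closed convex sets, can be
  spent on convenient test problems. Singletons \<open>\<Omega>\<close> show that \<open>q = \<kappa> u\<close> for one real number \<open>\<kappa>\<close>; and
  \<open>\<kappa> < 0\<close>, because otherwise the paraboloid \<open>m/2 |y|\<^sup>2\<close> on a segment around the origin would give two
  fixed points, one at the centre and one at an end (\<open>force_negative_gain\<close>). Therefore a fixed point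
  satisfies \<open>\<langle>\<nabla>f(y), w - y\<rangle> \<ge> 0\<close> for all \<open>w \<in> \<Omega>\<close>, which for a strongly convex \<open>f\<close> singles out the
  unique minimizer over \<open>\<Omega>\<close> (\<open>S_class_minimizer\<close>).
\<close>

section \<open>Quadratic forms on block vectors\<close>

text \<open>
  The arguments are functions on \<open>nat\<close>, of which only the first \<open>N\<close> values count: with the product
  topology on \<open>nat \<Rightarrow> 'v\<close>, compactness and continuity make sense for every \<open>N\<close> within one type.
\<close>

definition kron_form :: "nat \<Rightarrow> real mat \<Rightarrow> (nat \<Rightarrow> 'v::real_inner) \<Rightarrow> (nat \<Rightarrow> 'v) \<Rightarrow> real" where
  "kron_form N X h k = (\<Sum>i<N. inner (h i) (\<Sum>j<N. X $$ (i, j) *\<^sub>R k j))"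

lemma kron_mult_vec_index:
  "i < dim_row X \<Longrightarrow> vec_index (X *\<^sub>k x) i = (\<Sum>j<dim_col X. X $$ (i, j) *\<^sub>R vec_index x j)"
  by (simp add: kron_mult_vec_def)

lemma kron_mult_vec_dim [simp]: "dim_vec (X *\<^sub>k x) = dim_row X"
  by (simp add: kron_mult_vec_def)

lemma kron_form_cong:
  assumes "\<And>i. i < N \<Longrightarrow> h i = h' i" "\<And>i. i < N \<Longrightarrow> k i = k' i"
  shows "kron_form N X h k = kron_form N X h' k'"
  unfolding kron_form_def using assms by simp

lemma kron_form_mult_vec:
  assumes "X \<in> carrier_mat N N"
  shows "kron_form N X h (vec_index x) = (\<Sum>i<N. inner (h i) (vec_index (X *\<^sub>k x) i))"
  using assms by (simp add: kron_form_def kron_mult_vec_index)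

lemma kron_quad_eq_kron_form:
  assumes "X \<in> carrier_mat N N" "x \<in> carrier_vec N"
  shows "kron_quad X x = kron_form N X (vec_index x) (vec_index x)"
  using assms by (simp add: kron_quad_def kron_form_mult_vec)

lemma kron_form_sym:
  assumes "X \<in> carrier_mat N N" "transpose_mat X = X"
  shows "kron_form N X h k = kron_form N X k h"
proof -
  have sym: "X $$ (i, j) = X $$ (j, i)" if "i < N" "j < N" for i j
    using assms that by (metis carrier_matD index_transpose_mat(1))
  have "kron_form N X h k = (\<Sum>i<N. \<Sum>j<N. X $$ (i, j) * inner (h i) (k j))"
    by (simp add: kron_form_def inner_sum_right)
  also have "\<dots> = (\<Sum>j<N. \<Sum>i<N. X $$ (i, j) * inner (h i) (k j))"
    by (rule sum.swap)
  also have "\<dots> = kron_form N X k h"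
    unfolding kron_form_def inner_sum_right
    by (intro sum.cong refl) (simp add: sym inner_commute)
  finally show ?thesis .
qed

lemma kron_form_diff_left:
  "kron_form N X (\<lambda>i. h i - h' i) k = kron_form N X h k - kron_form N X h' k"
  by (simp add: kron_form_def inner_diff_left sum_subtractf)

lemma kron_form_diff_right:
  "kron_form N X h (\<lambda>i. k i - k' i) = kron_form N X h k - kron_form N X h k'"
  by (simp add: kron_form_def inner_diff_right sum_subtractf scaleR_diff_right)

lemma kron_form_scale_left:
  "kron_form N X (\<lambda>i. t *\<^sub>R h i) k = t * kron_form N X h k"
  by (simp add: kron_form_def sum_distrib_left)

lemma kron_form_scale_right:
  "kron_form N X h (\<lambda>i. t *\<^sub>R k i) = t * kron_form N X h k"
proof -
  have "(\<Sum>j<N. X $$ (i, j) *\<^sub>R t *\<^sub>R k j) = t *\<^sub>R (\<Sum>j<N. X $$ (i, j) *\<^sub>R k j)" for i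
    by (simp add: scaleR_sum_right mult.commute)
  then show ?thesis by (simp add: kron_form_def sum_distrib_left)
qed

lemma kron_form_square_diff:
  assumes "X \<in> carrier_mat N N" "transpose_mat X = X"
  shows "kron_form N X (\<lambda>i. h i - k i) (\<lambda>i. h i - k i)
    = kron_form N X h h - 2 * kron_form N X k h + kron_form N X k k"
  using kron_form_sym[OF assms, of h k]
  by (simp add: kron_form_diff_left kron_form_diff_right)

lemma kron_form_pos:
  fixes h :: "nat \<Rightarrow> 'v::real_inner"
  assumes X: "X \<in> carrier_mat N N" and pd: "kron_pos_def TYPE('v) X"
    and i: "i < N" "h i \<noteq> 0"
  shows "0 < kron_form N X h h"
proof -
  let ?x = "Matrix.vec N h"
  have "?x \<noteq> 0\<^sub>v N" using i by (metis index_vec index_zero_vec(1))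
  then have "0 < kron_quad X ?x"
    using pd X by (auto simp: kron_pos_def_def)
  also have "kron_quad X ?x = kron_form N X h h"
    using kron_quad_eq_kron_form[OF X, of ?x] by (simp add: kron_form_def)
  finally show ?thesis .
qed

lemma kron_form_nonneg:
  fixes h :: "nat \<Rightarrow> 'v::real_inner"
  assumes X: "X \<in> carrier_mat N N" and pd: "kron_pos_def TYPE('v) X"
  shows "0 \<le> kron_form N X h h"
proof (cases "\<exists>i<N. h i \<noteq> 0")
  case True then show ?thesis using kron_form_pos[OF X pd] by (metis less_imp_le)
next
  case False then show ?thesis by (simp add: kron_form_def)
qed

lemma continuous_on_block [continuous_intros]:
  "continuous_on A (\<lambda>h::nat \<Rightarrow> 'v::topological_space. h i)"
  by (rule continuous_on_subset[OF continuous_on_product_coordinates]) simp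

lemma continuous_on_kron_form_diag:
  "continuous_on A (\<lambda>h::nat \<Rightarrow> 'v::real_inner. kron_form N X (\<lambda>i. y i - h i) (\<lambda>i. y i - h i))"
  unfolding kron_form_def by (intro continuous_intros)

text \<open>
  Tychonoff's theorem: the set is a product of closed balls and singletons.
\<close>

lemma compact_bounded_blocks:
  "compact {h::nat \<Rightarrow> 'v::euclidean_space. (\<forall>i<N. norm (h i) \<le> R) \<and> (\<forall>i\<ge>N. h i = 0)}"
proof -
  have "compactin (product_topology (\<lambda>_. euclidean) UNIV)
      (PiE UNIV (\<lambda>i::nat. if i < N then cball (0::'v) R else {0}))"
    by (auto simp: compactin_PiE)
  moreover have "PiE UNIV (\<lambda>i::nat. if i < N then cball (0::'v) R else {0})
      = {h. (\<forall>i<N. norm (h i) \<le> R) \<and> (\<forall>i\<ge>N. h i = 0)}"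
    by (fastforce simp: PiE_iff split: if_splits)
  ultimately show ?thesis
    by (simp add: euclidean_product_topology)
qed

text \<open>
  The sphere in \<open>\<real>\<^sup>N\<^sup>d\<close> is compact, so a positive definite form has a positive minimum on it; the
  general bound follows by homogeneity.
\<close>

lemma kron_form_coercive:
  assumes X: "X \<in> carrier_mat N N" and pd: "kron_pos_def TYPE('v::euclidean_space) X"
  obtains c where "0 < c"
    "\<And>h::nat \<Rightarrow> 'v. c * (\<Sum>i<N. (norm (h i))\<^sup>2) \<le> kron_form N X h h"
proof -
  define Z where "Z = {h::nat \<Rightarrow> 'v. (\<forall>i<N. norm (h i) \<le> 1) \<and> (\<forall>i\<ge>N. h i = 0)}"
  define S where "S = {h::nat \<Rightarrow> 'v. (\<Sum>i<N. (norm (h i))\<^sup>2) = 1}"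
  have "closed S" unfolding S_def by (intro closed_Collect_eq continuous_intros)
  then have "compact (Z \<inter> S)"
    unfolding Z_def using compact_bounded_blocks compact_Int_closed by blast
  moreover have "continuous_on (Z \<inter> S) (\<lambda>h. kron_form N X h h)"
    unfolding kron_form_def by (intro continuous_intros)
  ultimately have inf: "\<exists>h0\<in>Z \<inter> S. \<forall>h\<in>Z \<inter> S. kron_form N X h0 h0 \<le> kron_form N X h h"
    if "Z \<inter> S \<noteq> {}"
    using that by (intro continuous_attains_inf)
  have pos: "0 < kron_form N X h h" if h: "h \<in> S" for h
  proof -
    have "\<exists>i<N. h i \<noteq> 0"
      using h unfolding S_def by (force intro: ccontr)
    then show ?thesis using kron_form_pos[OF X pd] by blast
  qed
  have "\<exists>c>0. \<forall>h\<in>Z \<inter> S. c \<le> kron_form N X h h"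
  proof (cases "Z \<inter> S = {}")
    case True then show ?thesis by (intro exI[of _ 1]) simp
  next
    case False then show ?thesis using inf pos by blast
  qed
  then obtain c where c: "0 < c" "\<And>h. h \<in> Z \<inter> S \<Longrightarrow> c \<le> kron_form N X h h"
    by blast
  have "c * (\<Sum>i<N. (norm (h i))\<^sup>2) \<le> kron_form N X h h" for h :: "nat \<Rightarrow> 'v"
  proof (cases "(\<Sum>i<N. (norm (h i))\<^sup>2) = 0")
    case True then show ?thesis using kron_form_nonneg[OF X pd] by simp
  next
    case False
    define s where "s = (\<Sum>i<N. (norm (h i))\<^sup>2)"
    have s: "0 < s" using False by (simp add: s_def order.not_eq_order_implies_strict sum_nonneg)
    define h' where "h' = (\<lambda>i. if i < N then (1 / sqrt s) *\<^sub>R h i else 0)"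
    have "(\<Sum>i<N. (norm (h' i))\<^sup>2) = (\<Sum>i<N. (norm (h i))\<^sup>2 / s)"
      using s by (intro sum.cong) (auto simp: h'_def power_divide)
    also have "\<dots> = 1" using s by (simp add: sum_divide_distrib[symmetric] s_def[symmetric])
    finally have sum1: "(\<Sum>i<N. (norm (h' i))\<^sup>2) = 1" .
    have "(norm (h' i))\<^sup>2 \<le> 1" if "i < N" for i
      unfolding sum1[symmetric] using that by (intro member_le_sum) auto
    then have "h' \<in> Z \<inter> S"
      using sum1 by (auto simp: Z_def S_def h'_def abs_square_le_1)
    then have "c \<le> kron_form N X h' h'" using c(2) by blast
    also have "\<dots> = kron_form N X (\<lambda>i. (1 / sqrt s) *\<^sub>R h i) (\<lambda>i. (1 / sqrt s) *\<^sub>R h i)"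
      by (rule kron_form_cong) (auto simp: h'_def)
    also have "\<dots> = kron_form N X h h / s"
      unfolding kron_form_scale_left kron_form_scale_right using s by simp
    finally show ?thesis using s by (simp add: s_def[symmetric] field_simps)
  qed
  then show thesis using c(1) that by blast
qed

section \<open>Projection in a weighted norm\<close>

text \<open>
  \<^const>\<open>proj\<close> selects a minimizer with a choice operator and says nothing unless there is one. By
  coercivity the search may be restricted to a bounded, hence compact, set.
\<close>

lemma kron_projection_exists:
  fixes S :: "'v::euclidean_space vec set"
  assumes X: "X \<in> carrier_mat N N" and pd: "kron_pos_def TYPE('v) X"
    and S: "S \<subseteq> carrier_vec N" "S \<noteq> {}" and cl: "closed {h. Matrix.vec N h \<in> S}"
    and y: "y \<in> carrier_vec N"
  obtains x where "is_arg_min (\<lambda>v. kron_quad X (y - v)) (\<lambda>v. v \<in> S) x"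
proof -
  let ?q = "\<lambda>h. kron_form N X (\<lambda>i. vec_index y i - h i) (\<lambda>i. vec_index y i - h i)"
  have q: "kron_quad X (y - v) = ?q (vec_index v)" if "v \<in> carrier_vec N" for v
    using kron_quad_eq_kron_form[OF X, of "y - v"] y that
    by (auto intro!: kron_form_cong)
  obtain v0 where v0: "v0 \<in> S" using S by blast
  obtain c where c: "0 < c" "\<And>h::nat \<Rightarrow> 'v. c * (\<Sum>i<N. (norm (h i))\<^sup>2) \<le> kron_form N X h h"
    using kron_form_coercive[OF X pd] by blast
  define R where "R = (\<Sum>i<N. norm (vec_index y i)) + sqrt (?q (vec_index v0) / c)"
  define Z where "Z = {h::nat \<Rightarrow> 'v. (\<forall>i<N. norm (h i) \<le> R) \<and> (\<forall>i\<ge>N. h i = 0)}"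
  define C where "C = {h. Matrix.vec N h \<in> S}"
  \<comment> \<open>A competitor that is at least as good as \<open>v0\<close> has all its blocks in the ball of radius \<open>R\<close>.\<close>
  have inZ: "(\<lambda>i. if i < N then vec_index v i else 0) \<in> Z \<inter> C"
    if v: "v \<in> S" "?q (vec_index v) \<le> ?q (vec_index v0)" for v
  proof -
    have vc: "v \<in> carrier_vec N" using v S by blast
    have "norm (vec_index v i) \<le> R" if i: "i < N" for i
    proof -
      have "(norm (vec_index y i - vec_index v i))\<^sup>2
          \<le> (\<Sum>i<N. (norm (vec_index y i - vec_index v i))\<^sup>2)"
        using i by (intro member_le_sum) auto
      also have "\<dots> \<le> ?q (vec_index v) / c"
        using c(2)[of "\<lambda>i. vec_index y i - vec_index v i"] c(1) by (simp add: field_simps)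
      also have "\<dots> \<le> ?q (vec_index v0) / c"
        using v(2) c(1) by (simp add: divide_right_mono)
      finally have "norm (vec_index y i - vec_index v i) \<le> sqrt (?q (vec_index v0) / c)"
        by (rule real_le_rsqrt)
      moreover have "norm (vec_index y i) \<le> (\<Sum>i<N. norm (vec_index y i))"
        using i by (intro member_le_sum) auto
      ultimately show ?thesis
        unfolding R_def using norm_triangle_sub[of "vec_index v i" "vec_index y i"]
        by (simp add: norm_minus_commute)
    qed
    moreover have "Matrix.vec N (\<lambda>i. if i < N then vec_index v i else 0) = v"
      using vc by (intro eq_vecI) auto
    ultimately show ?thesis using v by (auto simp: Z_def C_def)
  qed
  have "compact (Z \<inter> C)"
    unfolding Z_def C_def using compact_bounded_blocks cl compact_Int_closed by blast
  moreover have "Z \<inter> C \<noteq> {}" using inZ[OF v0] by blast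
  ultimately have "\<exists>h\<in>Z \<inter> C. \<forall>h'\<in>Z \<inter> C. ?q h \<le> ?q h'"
    by (intro continuous_attains_inf continuous_on_kron_form_diag)
  then obtain h where h: "h \<in> Z \<inter> C" "\<And>h'. h' \<in> Z \<inter> C \<Longrightarrow> ?q h \<le> ?q h'"
    by blast
  let ?x = "Matrix.vec N h"
  have xS: "?x \<in> S" using h(1) by (simp add: C_def)
  have qx: "?q (vec_index ?x) = ?q h" by (rule kron_form_cong) auto
  have restrict: "?q (\<lambda>i. if i < N then vec_index v i else 0) = ?q (vec_index v)" for v
    by (rule kron_form_cong) auto
  have "?q h \<le> ?q (vec_index v)" if v: "v \<in> S" for v
  proof (cases "?q (vec_index v) \<le> ?q (vec_index v0)")
    case True then show ?thesis using h(2)[OF inZ[OF v]] restrict[of v] by simp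
  next
    case False then show ?thesis using h(2)[OF inZ[OF v0]] restrict[of v0] by simp
  qed
  then have "kron_quad X (y - ?x) \<le> kron_quad X (y - v)" if "v \<in> S" for v
    using that q[of v] q[of ?x] qx S(1) by auto
  then show thesis using xS that[of ?x] by (auto simp: is_arg_min_linorder)
qed

text \<open>
  Used for the first-order condition at a minimizer: along a short segment the linear decrease
  \<open>t * b\<close> outweighs the quadratic term \<open>t\<^sup>2 * e\<close>.
\<close>

lemma small_step:
  fixes b e :: real
  assumes "0 < b" "0 \<le> e"
  obtains t where "0 < t" "t \<le> 1" "t * e < b"
proof
  show "0 < min 1 (b / (e + 1))" using assms by simp
  have "min 1 (b / (e + 1)) * e \<le> b / (e + 1) * e" using assms by (intro mult_right_mono) auto
  also have "\<dots> < b" using assms by (simp add: field_simps)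
  finally show "min 1 (b / (e + 1)) * e < b" .
qed simp

text \<open>
  The obtuse-angle criterion: the weighted squared distance along a segment of \<open>S\<close> starting at \<open>x\<close> is
  a quadratic polynomial whose slope at \<open>x\<close> is \<open>-2\<close> times the sum on the right.
\<close>

lemma proj_iff_variational_inequality:
  fixes S :: "'v::euclidean_space vec set"
  assumes X: "X \<in> carrier_mat N N" and pd: "kron_pos_def TYPE('v) X"
    and S: "S \<subseteq> carrier_vec N" "S \<noteq> {}" and cl: "closed {h. Matrix.vec N h \<in> S}"
    and cvx: "\<And>v w t. v \<in> S \<Longrightarrow> w \<in> S \<Longrightarrow> 0 < t \<Longrightarrow> t \<le> 1 \<Longrightarrow>
      Matrix.vec N (\<lambda>i. vec_index v i + t *\<^sub>R (vec_index w i - vec_index v i)) \<in> S"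
    and y: "y \<in> carrier_vec N"
  shows "x = proj X S y \<longleftrightarrow> x \<in> S \<and> (\<forall>v\<in>S.
    (\<Sum>i<N. inner (vec_index v i - vec_index x i) (vec_index (X *\<^sub>k (y - x)) i)) \<le> 0)"
proof -
  let ?arg = "is_arg_min (\<lambda>v. kron_quad X (y - v)) (\<lambda>v. v \<in> S)"
  let ?B = "\<lambda>x v. kron_form N X (\<lambda>i. vec_index v i - vec_index x i) (\<lambda>i. vec_index y i - vec_index x i)"
  let ?E = "\<lambda>x v. kron_form N X (\<lambda>i. vec_index v i - vec_index x i) (\<lambda>i. vec_index v i - vec_index x i)"
  have symX: "transpose_mat X = X" using pd by (simp add: kron_pos_def_def)
  have B: "(\<Sum>i<N. inner (vec_index v i - vec_index x i) (vec_index (X *\<^sub>k (y - x)) i)) = ?B x v"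
    if "x \<in> S" for x v
  proof -
    have "x \<in> carrier_vec N" using that S by blast
    then have "kron_form N X (\<lambda>i. vec_index v i - vec_index x i) (vec_index (y - x)) = ?B x v"
      using y by (intro kron_form_cong) auto
    then show ?thesis using kron_form_mult_vec[OF X] by metis
  qed
  have expand: "kron_quad X (y - v) = kron_quad X (y - x) - 2 * ?B x v + ?E x v"
    if "x \<in> carrier_vec N" "v \<in> carrier_vec N" for x v
  proof -
    have q: "kron_quad X (y - w)
        = kron_form N X (\<lambda>i. vec_index y i - vec_index w i) (\<lambda>i. vec_index y i - vec_index w i)"
      if "w \<in> carrier_vec N" for w
      using kron_quad_eq_kron_form[OF X, of "y - w"] y that by (auto intro!: kron_form_cong)
    show ?thesis
      using kron_form_square_diff[OF X symX, of "\<lambda>i. vec_index y i - vec_index x i"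
          "\<lambda>i. vec_index v i - vec_index x i"] q that by simp
  qed
  have VI: "?B x v \<le> 0" if x: "?arg x" and v: "v \<in> S" for x v
  proof (rule ccontr)
    assume neg: "\<not> ?B x v \<le> 0"
    have xS: "x \<in> S" and min: "\<And>w. w \<in> S \<Longrightarrow> kron_quad X (y - x) \<le> kron_quad X (y - w)"
      using x by (auto simp: is_arg_min_linorder)
    have E0: "0 \<le> ?E x v" by (rule kron_form_nonneg[OF X pd])
    obtain t where t: "0 < t" "t \<le> 1" "t * ?E x v < 2 * ?B x v"
      using small_step[OF _ E0, of "2 * ?B x v"] neg by auto
    let ?w = "Matrix.vec N (\<lambda>i. vec_index x i + t *\<^sub>R (vec_index v i - vec_index x i))"
    have w: "?w \<in> S" using cvx xS v t by blast
    have "?B x ?w = kron_form N X (\<lambda>i. t *\<^sub>R (vec_index v i - vec_index x i)) (\<lambda>i. vec_index y i - vec_index x i)"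
      by (rule kron_form_cong) auto
    moreover have "?E x ?w = kron_form N X (\<lambda>i. t *\<^sub>R (vec_index v i - vec_index x i))
        (\<lambda>i. t *\<^sub>R (vec_index v i - vec_index x i))"
      by (rule kron_form_cong) auto
    ultimately have "kron_quad X (y - ?w) = kron_quad X (y - x) - 2 * (t * ?B x v) + t * (t * ?E x v)"
      using expand[of x ?w] xS w S(1) by (auto simp: kron_form_scale_left kron_form_scale_right)
    then have "2 * (t * ?B x v) \<le> t * (t * ?E x v)" using min[OF w] by simp
    then have "2 * ?B x v \<le> t * ?E x v" using t(1) by (simp add: mult.left_commute[of 2])
    then show False using t(3) by simp
  qed
  have unique: "z = x" if x: "x \<in> S" "\<forall>v\<in>S. ?B x v \<le> 0" and z: "?arg z" for x z
  proof (rule ccontr)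
    assume "z \<noteq> x"
    have zS: "z \<in> S" using z by (simp add: is_arg_min_linorder)
    then have car: "x \<in> carrier_vec N" "z \<in> carrier_vec N" using x S by auto
    obtain i where i: "i < N" "vec_index z i \<noteq> vec_index x i"
      using \<open>z \<noteq> x\<close> car eq_vecI by (metis carrier_vecD)
    have "0 < ?E x z" using kron_form_pos[OF X pd i(1)] i(2) by simp
    then have "kron_quad X (y - x) < kron_quad X (y - z)"
      using expand[OF car] x(2) zS by force
    then show False using z x(1) by (auto simp: is_arg_min_def)
  qed
  obtain z where z: "?arg z" using kron_projection_exists[OF X pd S cl y] by blast
  have arg: "?arg (proj X S y)"
    unfolding proj_def arg_min_on_def arg_min_def by (rule someI[where P = ?arg, OF z])
  show ?thesis
  proof
    assume "x = proj X S y"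
    then have "?arg x" using arg by simp
    then show "x \<in> S \<and> (\<forall>v\<in>S.
        (\<Sum>i<N. inner (vec_index v i - vec_index x i) (vec_index (X *\<^sub>k (y - x)) i)) \<le> 0)"
      using VI B by (auto simp: is_arg_min_linorder)
  next
    assume "x \<in> S \<and> (\<forall>v\<in>S.
        (\<Sum>i<N. inner (vec_index v i - vec_index x i) (vec_index (X *\<^sub>k (y - x)) i)) \<le> 0)"
    then show "x = proj X S y" using unique[OF _ _ arg] B by metis
  qed
qed

section \<open>Fixed points as solutions of a linear system and a variational inequality\<close>

text \<open>
  In the canonical structure the equation \<open>A\<^sub>r\<^sub>1 \<xi>\<^sub>1 = (I - A\<^sub>r\<^sub>r) \<xi>\<^sub>2\<close> is built from shift rows: each block
  equals the one before it, and the first block of \<open>\<xi>\<^sub>2\<close> equals \<open>\<xi>\<^sub>1\<close>.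
\<close>

lemma Y_set_iff:
  fixes a :: "'v::real_vector"
  assumes A: "canonical_A n r At" and r: "1 \<le> r" "r \<le> n"
  shows "(a, b) \<in> Y_set r (aug_A n r l At) \<Omega> \<longleftrightarrow>
    b \<in> carrier_vec (r - 1) \<and> a \<in> \<Omega> \<and> (\<forall>i<r - 1. vec_index b i = a)"
proof (cases "b \<in> carrier_vec (r - 1)")
  case True
  let ?A = "aug_A n r l At"
  let ?lhs = "part_A_r1 r ?A *\<^sub>k single_block a" and ?rhs = "(1\<^sub>m (r - 1) - part_A_rr r ?A) *\<^sub>k b"
  have entry: "?A $$ (Suc i, j) = (if j = i then 1 else 0)" if "i < r - 1" "j < n" for i j
    using A that r by (auto simp: aug_A_def canonical_A_def)
  have lhs: "vec_index ?lhs i = (if i = 0 then a else 0)" if "i < r - 1" for i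
    using that r entry[of i 0] by (simp add: part_A_r1_def kron_mult_vec_def)
  have rhs: "vec_index ?rhs i = vec_index b i - (if i = 0 then 0 else vec_index b (i - 1))"
    if i: "i < r - 1" for i
  proof -
    have "vec_index ?rhs i
      = (\<Sum>j<r - 1. ((if i = j then 1 else 0) - (if Suc j = i then 1 else 0)) *\<^sub>R vec_index b j)"
      using i r by (auto simp: part_A_rr_def kron_mult_vec_def entry intro!: sum.cong)
    also have "\<dots> = (\<Sum>j<r - 1. (if i = j then vec_index b j else 0))
        - (\<Sum>j<r - 1. (if j = i - 1 then (if i = 0 then 0 else vec_index b j) else 0))"
      unfolding sum_subtractf[symmetric] by (rule sum.cong) auto
    finally show ?thesis using i by (cases i) (simp_all add: sum.delta)
  qed
  have dims: "dim_vec ?lhs = r - 1" "dim_vec ?rhs = r - 1"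
    by (simp_all add: part_A_r1_def part_A_rr_def)
  have eq: "vec_index ?lhs i = vec_index ?rhs i
      \<longleftrightarrow> vec_index b i = (if i = 0 then a else vec_index b (i - 1))" if "i < r - 1" for i
    unfolding lhs[OF that] rhs[OF that] by (auto simp: algebra_simps)
  have "?lhs = ?rhs \<longleftrightarrow> (\<forall>i<r - 1. vec_index ?lhs i = vec_index ?rhs i)"
    using dims by (auto intro: eq_vecI)
  also have "\<dots> \<longleftrightarrow> (\<forall>i<r - 1. vec_index b i = (if i = 0 then a else vec_index b (i - 1)))"
    using eq by blast
  also have "\<dots> \<longleftrightarrow> (\<forall>i<r - 1. vec_index b i = a)"
  proof
    assume step: "\<forall>i<r - 1. vec_index b i = (if i = 0 then a else vec_index b (i - 1))"
    have "vec_index b i = a" if "i < r - 1" for i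
      using that by (induction i) (simp_all add: step)
    then show "\<forall>i<r - 1. vec_index b i = a" by blast
  qed auto
  finally show ?thesis using True by (simp add: Y_set_def)
qed (simp add: Y_set_def)

lemma D_set_eq:
  fixes \<Omega> :: "'v::real_vector set"
  assumes A: "canonical_A n r At" and r: "1 \<le> r" "r \<le> n"
  shows "D_set n r l (aug_A n r l At) \<Omega> =
    {x \<in> carrier_vec (n + 2 * l). vec_index x 0 \<in> \<Omega> \<and> (\<forall>i<r. vec_index x 0 = vec_index x i)}"
    (is "?D = ?E")
proof
  show "?D \<subseteq> ?E"
  proof
    fix x assume "x \<in> ?D"
    then obtain a b e where x: "x = vCons a (b @\<^sub>v e)" and b: "b \<in> carrier_vec (r - 1)" "a \<in> \<Omega>"
      "\<forall>i<r - 1. vec_index b i = a" and e: "e \<in> carrier_vec (n + 2 * l - r)"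
      by (auto simp: D_set_def Y_set_iff[OF A r])
    have "vec_index x i = a" if "i < r" for i
      using that b by (cases i) (auto simp: x)
    moreover have "x \<in> carrier_vec (n + 2 * l)"
      using b(1) e r unfolding x by (intro carrier_vecI) simp
    moreover have "vec_index x 0 = a" by (simp add: x)
    ultimately show "x \<in> ?E" using b(2) by simp
  qed
  show "?E \<subseteq> ?D"
  proof
    fix x assume "x \<in> ?E"
    then have x: "x \<in> carrier_vec (n + 2 * l)" "vec_index x 0 \<in> \<Omega>"
      and blocks: "\<And>i. i < r \<Longrightarrow> vec_index x i = vec_index x 0" by auto
    let ?b = "Matrix.vec (r - 1) (\<lambda>i. vec_index x (i + 1))"
    let ?e = "Matrix.vec (n + 2 * l - r) (\<lambda>i. vec_index x (i + r))"
    have "x = vCons (vec_index x 0) (?b @\<^sub>v ?e)"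
    proof (rule eq_vecI)
      show dim: "dim_vec x = dim_vec (vCons (vec_index x 0) (?b @\<^sub>v ?e))" using x(1) r by simp
      fix i assume i: "i < dim_vec (vCons (vec_index x 0) (?b @\<^sub>v ?e))"
      then show "vec_index x i = vec_index (vCons (vec_index x 0) (?b @\<^sub>v ?e)) i"
      proof (cases i)
        case (Suc k)
        show ?thesis
        proof (cases "k < r - 1")
          case True then show ?thesis using Suc i by simp
        next
          case False
          then have "k - (r - 1) < n + 2 * l - r" "k - (r - 1) + r = i" using Suc i r by auto
          then show ?thesis using Suc i r False by simp
        qed
      qed simp
    qed
    moreover have "vec_index ?b i = vec_index x 0" if "i < r - 1" for i
      using blocks[of "i + 1"] that by simp
    then have "(vec_index x 0, ?b) \<in> Y_set r (aug_A n r l At) \<Omega>"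
      unfolding Y_set_iff[OF A r] using x(2) by (metis vec_carrier)
    ultimately show "x \<in> ?D"
      unfolding D_set_def by (intro CollectI exI[of _ "vec_index x 0"] exI[of _ ?b] exI[of _ ?e]) simp
  qed
qed

text \<open>
  The displacement of \<open>x\<close> by one unprojected step with input \<open>u\<close>, measured in the metric \<open>P\<close>. The
  point \<open>x\<close> is its own projection after that step iff this vector lies in the normal cone at \<open>x\<close> of the
  constraint set.
\<close>

definition defect ::
    "nat \<Rightarrow> nat \<Rightarrow> nat \<Rightarrow> real mat \<Rightarrow> real \<Rightarrow> real mat \<Rightarrow> 'v::real_vector vec \<Rightarrow> 'v \<Rightarrow> 'v vec" where
  "defect n r l At g P x u =
     P *\<^sub>k (aug_A n r l At *\<^sub>k x + aug_B n l g *\<^sub>k single_block u - x)"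

text \<open>
  The linear part of the normal-cone condition: the blocks that the constraint set leaves free carry
  no defect. What remains, by \<open>fixed_point_iff_stationary\<close>, is a condition on the total defect \<open>force\<close>
  of the first \<open>r\<close> blocks, which the constraint set moves together.
\<close>

definition stationary ::
    "nat \<Rightarrow> nat \<Rightarrow> nat \<Rightarrow> real mat \<Rightarrow> real \<Rightarrow> real mat \<Rightarrow> 'v::real_vector vec \<Rightarrow> 'v \<Rightarrow> bool" where
  "stationary n r l At g P x u \<longleftrightarrow> x \<in> carrier_vec (n + 2 * l) \<and>
     (\<forall>i<r. vec_index x 0 = vec_index x i) \<and>
     (\<forall>i\<in>{r..<n + 2 * l}. vec_index (defect n r l At g P x u) i = 0)"

definition force ::
    "nat \<Rightarrow> nat \<Rightarrow> nat \<Rightarrow> real mat \<Rightarrow> real \<Rightarrow> real mat \<Rightarrow> 'v::real_vector vec \<Rightarrow> 'v \<Rightarrow> 'v" where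
  "force n r l At g P x u = (\<Sum>i<r. vec_index (defect n r l At g P x u) i)"

lemma aug_A_carrier [simp]:
  "At \<in> carrier_mat n n \<Longrightarrow> aug_A n r l At \<in> carrier_mat (n + 2 * l) (n + 2 * l)"
  by (auto simp: aug_A_def filt_A_def filt_A0_def)

lemma aug_B_carrier [simp]: "aug_B n l g \<in> carrier_mat (n + 2 * l) 1"
  by (auto simp: aug_B_def canonical_B_def filt_Bu_def filt_B0_def append_rows_def)

text \<open>
  A feasible direction moves the first \<open>r\<close> blocks by one common vector \<open>w - x\<^sub>0\<close> and the other blocks
  arbitrarily. Testing the obtuse-angle criterion with these two kinds of direction separately gives
  the two parts of the condition.
\<close>

lemma fixed_point_iff_stationary:
  fixes \<Omega> :: "'v::euclidean_space set"
  assumes A: "canonical_A n r At" and r: "1 \<le> r" "r \<le> n"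
    and P: "P \<in> carrier_mat (n + 2 * l) (n + 2 * l)" and pd: "kron_pos_def TYPE('v) P"
    and \<Omega>: "\<Omega> \<noteq> {}" "closed \<Omega>" "convex \<Omega>"
  shows "fixed_point n r l At g P f \<Omega> x \<longleftrightarrow>
    stationary n r l At g P x (grad f (vec_index x 0)) \<and> vec_index x 0 \<in> \<Omega> \<and>
    (\<forall>w\<in>\<Omega>. inner (w - vec_index x 0) (force n r l At g P x (grad f (vec_index x 0))) \<le> 0)"
    (is "_ \<longleftrightarrow> ?R")
proof -
  let ?N = "n + 2 * l"
  let ?D = "D_set n r l (aug_A n r l At) \<Omega>"
  let ?u = "grad f (alg_output n r l x)"
  let ?y = "aug_A n r l At *\<^sub>k x + aug_B n l g *\<^sub>k single_block ?u"
  let ?p = "vec_index (defect n r l At g P x ?u)"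
  have At: "At \<in> carrier_mat n n" using A by (simp add: canonical_A_def)
  have D: "?D = {x \<in> carrier_vec ?N. vec_index x 0 \<in> \<Omega> \<and> (\<forall>i<r. vec_index x 0 = vec_index x i)}"
    by (rule D_set_eq[OF A r])
  have r0: "0 < ?N" "0 < r" using r by auto
  have "?D \<noteq> {}"
  proof -
    obtain w where "w \<in> \<Omega>" using \<Omega> by blast
    then have "Matrix.vec ?N (\<lambda>_. w) \<in> ?D" unfolding D using r by auto
    then show ?thesis by blast
  qed
  moreover have "closed {h. Matrix.vec ?N h \<in> ?D}"
  proof -
    have "{h. Matrix.vec ?N h \<in> ?D} = (\<lambda>h. h 0) -` \<Omega> \<inter> (\<Inter>i\<in>{..<r}. {h. h 0 = h i})"
      unfolding D using r by auto
    moreover have "closed ((\<lambda>h::nat \<Rightarrow> 'v. h 0) -` \<Omega>)"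
      by (intro closed_vimage continuous_on_block \<Omega>)
    moreover have "closed (\<Inter>i\<in>{..<r}. {h::nat \<Rightarrow> 'v. h 0 = h i})"
      by (intro closed_INT ballI closed_Collect_eq continuous_on_block)
    ultimately show ?thesis by (simp add: closed_Int)
  qed
  moreover have "Matrix.vec ?N (\<lambda>i. vec_index v i + t *\<^sub>R (vec_index w i - vec_index v i)) \<in> ?D"
    if "v \<in> ?D" "w \<in> ?D" "0 < t" "t \<le> 1" for v w t
  proof -
    have "vec_index v 0 + t *\<^sub>R (vec_index w 0 - vec_index v 0) \<in> \<Omega>"
      using convexD_alt[OF \<Omega>(3), of "vec_index v 0" "vec_index w 0" t] that
      by (auto simp: D algebra_simps)
    then show ?thesis using that r unfolding D by auto
  qed
  moreover have "?y \<in> carrier_vec ?N"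
    using aug_A_carrier[OF At, of r l] aug_B_carrier[of n l g] by (intro carrier_vecI) simp
  moreover have "?D \<subseteq> carrier_vec ?N" unfolding D by auto
  ultimately have "x = proj P ?D ?y \<longleftrightarrow> x \<in> ?D \<and> (\<forall>v\<in>?D.
      (\<Sum>i<?N. inner (vec_index v i - vec_index x i) (?p i)) \<le> 0)"
    unfolding defect_def by (intro proj_iff_variational_inequality[OF P pd])
  then have fp: "fixed_point n r l At g P f \<Omega> x \<longleftrightarrow> x \<in> ?D \<and> (\<forall>v\<in>?D.
      (\<Sum>i<?N. inner (vec_index v i - vec_index x i) (?p i)) \<le> 0)"
    unfolding fixed_point_def proj_step_def D by auto
  have out: "alg_output n r l x = vec_index x 0" if "x \<in> ?D"
    by (rule alg_output_eq_first_block[OF A r that])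
  have split: "(\<Sum>i<?N. inner (vec_index v i - vec_index x i) (?p i))
      = inner (vec_index v 0 - vec_index x 0) (force n r l At g P x ?u)
        + (\<Sum>i\<in>{r..<?N}. inner (vec_index v i - vec_index x i) (?p i))"
    if "x \<in> ?D" "v \<in> ?D" for v
  proof -
    have "{..<?N} = {..<r} \<union> {r..<?N}" using r by auto
    then have "(\<Sum>i<?N. inner (vec_index v i - vec_index x i) (?p i))
      = (\<Sum>i<r. inner (vec_index v i - vec_index x i) (?p i))
        + (\<Sum>i\<in>{r..<?N}. inner (vec_index v i - vec_index x i) (?p i))"
      by (simp add: sum.union_disjoint ivl_disj_int_one)
    also have "(\<Sum>i<r. inner (vec_index v i - vec_index x i) (?p i))
      = (\<Sum>i<r. inner (vec_index v 0 - vec_index x 0) (?p i))"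
    proof (intro sum.cong refl)
      fix i assume "i \<in> {..<r}"
      then have "vec_index v i = vec_index v 0" "vec_index x i = vec_index x 0"
        using that unfolding D by auto
      then show "inner (vec_index v i - vec_index x i) (?p i)
        = inner (vec_index v 0 - vec_index x 0) (?p i)" by simp
    qed
    finally show ?thesis by (simp add: force_def inner_sum_right)
  qed
  show ?thesis
  proof
    assume "fixed_point n r l At g P f \<Omega> x"
    then have x: "x \<in> ?D" and VI: "\<And>v. v \<in> ?D \<Longrightarrow>
        inner (vec_index v 0 - vec_index x 0) (force n r l At g P x ?u)
        + (\<Sum>i\<in>{r..<?N}. inner (vec_index v i - vec_index x i) (?p i)) \<le> 0"
      using fp split by auto
    have xc: "x \<in> carrier_vec ?N" "\<forall>i<r. vec_index x 0 = vec_index x i" "vec_index x 0 \<in> \<Omega>"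
      using x unfolding D by auto
    have "?p i = 0" if i: "i \<in> {r..<?N}" for i
    proof -
      \<comment> \<open>Block \<open>i\<close> of a point of \<open>\<D>\<close> is free, so it may be moved along the defect itself.\<close>
      define v where "v = Matrix.vec ?N (\<lambda>j. if j = i then vec_index x j + ?p i else vec_index x j)"
      have "vec_index v j = vec_index x j" if "j < r" for j
        using that i r by (simp add: v_def)
      then have v0: "vec_index v 0 = vec_index x 0" and "\<And>j. j < r \<Longrightarrow> vec_index v 0 = vec_index v j"
        using xc(2) r0(2) by metis+
      moreover have "v \<in> carrier_vec ?N" by (simp add: v_def)
      ultimately have "v \<in> ?D" using xc(3) unfolding D by simp
      moreover note v0
      moreover have "(\<Sum>j\<in>{r..<?N}. inner (vec_index v j - vec_index x j) (?p j))
          = (\<Sum>j\<in>{r..<?N}. if j = i then inner (?p i) (?p i) else 0)"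
        by (intro sum.cong) (auto simp: v_def)
      ultimately have "inner (?p i) (?p i) \<le> 0" using VI[of v] i by simp
      then show ?thesis by (metis antisym inner_ge_zero inner_eq_zero_iff)
    qed
    moreover have "inner (w - vec_index x 0) (force n r l At g P x ?u) \<le> 0" if w: "w \<in> \<Omega>" for w
    proof -
      define v where "v = Matrix.vec ?N (\<lambda>j. if j < r then w else vec_index x j)"
      have "vec_index v j = w" if "j < r" for j using that r by (simp add: v_def)
      then have "v \<in> ?D" "vec_index v 0 = w" using w r0 unfolding D by (simp_all add: v_def)
      moreover have "(\<Sum>j\<in>{r..<?N}. inner (vec_index v j - vec_index x j) (?p j)) = 0"
        by (intro sum.neutral) (auto simp: v_def)
      ultimately show ?thesis using VI[of v] by simp
    qed
    ultimately show ?R using xc out[OF x] unfolding stationary_def by metis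
  next
    assume R: ?R
    then have x: "x \<in> ?D" unfolding D stationary_def by blast
    have "(\<Sum>i<?N. inner (vec_index v i - vec_index x i) (?p i)) \<le> 0" if v: "v \<in> ?D" for v
    proof -
      have "(\<Sum>i\<in>{r..<?N}. inner (vec_index v i - vec_index x i) (?p i)) = 0"
        using R out[OF x] unfolding stationary_def by (intro sum.neutral) simp
      moreover have "vec_index v 0 \<in> \<Omega>" using v unfolding D by blast
      ultimately show ?thesis using split[OF x v] R out[OF x] by simp
    qed
    then show "fixed_point n r l At g P f \<Omega> x" using fp x by blast
  qed
qed

section \<open>Linearity of the fixed-point system\<close>

lemma kron_mult_vec_diff:
  assumes "x \<in> carrier_vec (dim_col X)" "y \<in> carrier_vec (dim_col X)"
  shows "X *\<^sub>k (x - y) = X *\<^sub>k x - X *\<^sub>k y"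
  using assms
  by (intro eq_vecI) (simp_all add: kron_mult_vec_index scaleR_diff_right sum_subtractf)

text \<open>
  Applying one linear map to every block commutes with \<open>X \<otimes> I\<^sub>d\<close>. This is how the Kronecker form
  enters the proof.
\<close>

lemma kron_mult_vec_map:
  assumes "linear T" "x \<in> carrier_vec (dim_col X)"
  shows "X *\<^sub>k map_vec T x = map_vec T (X *\<^sub>k x)"
  using assms
  by (intro eq_vecI) (simp_all add: kron_mult_vec_index linear_sum linear_scale)

lemma defect_carrier:
  "P \<in> carrier_mat N N \<Longrightarrow> defect n r l At g P x u \<in> carrier_vec N"
  by (intro carrier_vecI) (simp add: defect_def)

context
  fixes n r l :: nat and At P :: "real mat" and g :: real
  assumes A: "canonical_A n r At" and r: "1 \<le> r" "r \<le> n"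
    and P: "P \<in> carrier_mat (n + 2 * l) (n + 2 * l)"
begin

lemma system_dims:
  "dim_row (aug_A n r l At) = n + 2 * l" "dim_col (aug_A n r l At) = n + 2 * l"
  "dim_row (aug_B n l g) = n + 2 * l" "dim_col (aug_B n l g) = 1"
  "dim_row P = n + 2 * l" "dim_col P = n + 2 * l"
proof -
  have At: "At \<in> carrier_mat n n" using A by (simp add: canonical_A_def)
  show "dim_row (aug_A n r l At) = n + 2 * l" "dim_col (aug_A n r l At) = n + 2 * l"
    using carrier_matD[OF aug_A_carrier[OF At]] by auto
  show "dim_row (aug_B n l g) = n + 2 * l" "dim_col (aug_B n l g) = 1"
    using carrier_matD[OF aug_B_carrier] by auto
  show "dim_row P = n + 2 * l" "dim_col P = n + 2 * l" using P by auto
qed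

lemma defect_diff:
  assumes "x \<in> carrier_vec (n + 2 * l)" "x' \<in> carrier_vec (n + 2 * l)"
  shows "defect n r l At g P (x - x') (u - u')
    = defect n r l At g P x u - defect n r l At g P x' u'"
proof -
  let ?s = "\<lambda>x u. aug_A n r l At *\<^sub>k x + aug_B n l g *\<^sub>k single_block u - x"
  have "single_block (u - u') = single_block u - single_block u'" by auto
  then have eq: "?s (x - x') (u - u') = ?s x u - ?s x' u'"
    using assms
    by (intro eq_vecI) (simp_all add: kron_mult_vec_diff system_dims)
  have "?s z v \<in> carrier_vec (dim_col P)" if "z \<in> carrier_vec (n + 2 * l)" for z v
    unfolding system_dims using that by (intro carrier_vecI) simp
  then show ?thesis
    unfolding defect_def eq using assms by (intro kron_mult_vec_diff)
qed

lemma defect_map: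
  assumes T: "linear T" and x: "x \<in> carrier_vec (n + 2 * l)"
  shows "defect n r l At g P (map_vec T x) (T u) = map_vec T (defect n r l At g P x u)"
proof -
  let ?s = "\<lambda>x u. aug_A n r l At *\<^sub>k x + aug_B n l g *\<^sub>k single_block u - x"
  have "single_block (T u) = map_vec T (single_block u)" by auto
  then have eq: "?s (map_vec T x) (T u) = map_vec T (?s x u)"
    using x T
    by (intro eq_vecI) (simp_all add: kron_mult_vec_map system_dims linear_add linear_diff)
  have "?s x u \<in> carrier_vec (dim_col P)"
    unfolding system_dims using x by (intro carrier_vecI) simp
  then show ?thesis
    unfolding defect_def eq using T by (intro kron_mult_vec_map)
qed

lemma stationary_diff:
  assumes x: "stationary n r l At g P x u" and x': "stationary n r l At g P x' u'"
  shows "stationary n r l At g P (x - x') (u - u')"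
    and "force n r l At g P (x - x') (u - u') = force n r l At g P x u - force n r l At g P x' u'"
    and "vec_index (x - x') 0 = vec_index x 0 - vec_index x' 0"
proof -
  have car: "x \<in> carrier_vec (n + 2 * l)" "x' \<in> carrier_vec (n + 2 * l)"
    using x x' by (auto simp: stationary_def)
  have d: "vec_index (defect n r l At g P (x - x') (u - u')) i
      = vec_index (defect n r l At g P x u) i - vec_index (defect n r l At g P x' u') i"
    if "i < n + 2 * l" for i
    using that defect_diff[OF car] defect_carrier[OF P, of n r l At g x' u'] by simp
  have block: "vec_index (x - x') i = vec_index x i - vec_index x' i" if "i < n + 2 * l" for i
    using that car by simp
  show "vec_index (x - x') 0 = vec_index x 0 - vec_index x' 0" using block r by simp
  have "vec_index (x - x') 0 = vec_index (x - x') i" if "i < r" for i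
    using that r x x' block[of 0] block[of i] unfolding stationary_def by simp
  then show "stationary n r l At g P (x - x') (u - u')"
    using x x' d car unfolding stationary_def by simp
  show "force n r l At g P (x - x') (u - u') = force n r l At g P x u - force n r l At g P x' u'"
    unfolding force_def using d r by (simp add: sum_subtractf)
qed

lemma stationary_map:
  assumes T: "linear T" and x: "stationary n r l At g P x u"
  shows "stationary n r l At g P (map_vec T x) (T u)"
    and "force n r l At g P (map_vec T x) (T u) = T (force n r l At g P x u)"
    and "vec_index (map_vec T x) 0 = T (vec_index x 0)"
proof -
  have car: "x \<in> carrier_vec (n + 2 * l)" using x by (auto simp: stationary_def)
  have d: "vec_index (defect n r l At g P (map_vec T x) (T u)) i
      = T (vec_index (defect n r l At g P x u) i)" if "i < n + 2 * l" for i
    using that defect_map[OF T car] defect_carrier[OF P, of n r l At g x u] by simp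
  have block: "vec_index (map_vec T x) i = T (vec_index x i)" if "i < n + 2 * l" for i
    using that car by simp
  show "vec_index (map_vec T x) 0 = T (vec_index x 0)" using block r by simp
  have "vec_index (map_vec T x) 0 = vec_index (map_vec T x) i" if "i < r" for i
    using that r x block[of 0] block[of i] unfolding stationary_def by simp
  then show "stationary n r l At g P (map_vec T x) (T u)"
    using x d car linear_0[OF T] unfolding stationary_def by simp
  show "force n r l At g P (map_vec T x) (T u) = T (force n r l At g P x u)"
    unfolding force_def using d r by (simp add: linear_sum[OF T])
qed

section \<open>Equilibria of the augmented system\<close>

lemma aug_A_state_row:
  "i < n \<Longrightarrow> j < n + 2 * l \<Longrightarrow> aug_A n r l At $$ (i, j) = (if j < n then At $$ (i, j) else 0)"
  using A by (auto simp: aug_A_def canonical_A_def filt_A_def filt_A0_def)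

lemma aug_A_filter_row:
  assumes "n \<le> i" "i < n + 2 * l" "j < n + 2 * l"
  shows "aug_A n r l At $$ (i, j)
    = (if i = n then if j = r - 1 then 1 else 0
       else if i = n + l then 0 else if j = i - 1 then 1 else 0)"
proof -
  have By: "(filt_By l * canonical_C n r) $$ (k, j) = (if k = 0 \<and> j = r - 1 then 1 else 0)"
    if "k < 2 * l" "j < n" for k
    using that by (auto simp: filt_By_def filt_B0_def canonical_C_def append_rows_def scalar_prod_def)
  have FA: "filt_A l $$ (k, k') = (if k = k' + 1 \<and> k \<noteq> l then 1 else 0)"
    if "k < 2 * l" "k' < 2 * l" for k k'
    using that by (auto simp: filt_A_def filt_A0_def)
  have dims: "dim_row At = n" "dim_col At = n" "dim_row (filt_A l) = 2 * l" "dim_col (filt_A l) = 2 * l"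
    using A by (auto simp: canonical_A_def filt_A_def filt_A0_def)
  obtain k where k: "i = n + k" using assms(1) by (rule less_eqE)
  have entry: "aug_A n r l At $$ (i, j)
      = (if j < n then (filt_By l * canonical_C n r) $$ (k, j) else filt_A l $$ (k, j - n))"
    unfolding aug_A_def using assms dims k by (subst index_mat_four_block) simp_all
  show ?thesis
  proof (cases "j < n")
    case True
    then show ?thesis unfolding entry using By[of k] assms k by auto
  next
    case False
    then obtain k' where k': "j = n + k'" by (metis less_eqE not_less)
    have "j \<noteq> r - 1" using False r by linarith
    moreover have "filt_A l $$ (k, j - n) = (if k = k' + 1 \<and> k \<noteq> l then 1 else 0)"
      using FA[of k k'] assms k k' by simp
    ultimately show ?thesis unfolding entry using False k k' by auto
  qed
qed

text \<open>
  An equilibrium of the algorithm extends to the augmented system: with constant output \<open>w\<close> and input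
  \<open>0\<close> the two delay lines hold \<open>w\<close> and \<open>0\<close>. The shift rows make the first \<open>r\<close> blocks of the state equal
  to the output.
\<close>

lemma equilibrium_state:
  fixes w :: "'v::real_vector"
  assumes \<xi>: "\<xi> \<in> carrier_vec n" "At *\<^sub>k \<xi> = \<xi>" "canonical_C n r *\<^sub>k \<xi> = single_block w"
  obtains x where "stationary n r l At g P x 0" "vec_index x 0 = w" "force n r l At g P x 0 = 0"
proof -
  let ?N = "n + 2 * l"
  have At: "dim_row At = n" "dim_col At = n" using A by (auto simp: canonical_A_def)
  have row: "vec_index \<xi> i = (\<Sum>j<n. At $$ (i, j) *\<^sub>R vec_index \<xi> j)" if "i < n" for i
    using \<xi>(2) that At by (metis kron_mult_vec_index)
  have last: "vec_index \<xi> (r - 1) = w"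
  proof -
    have "w = (\<Sum>j<n. canonical_C n r $$ (0, j) *\<^sub>R vec_index \<xi> j)"
      using arg_cong[OF \<xi>(3), of "\<lambda>v. vec_index v 0"]
      by (simp add: kron_mult_vec_index canonical_C_def)
    also have "\<dots> = (\<Sum>j<n. if j = r - 1 then vec_index \<xi> j else 0)"
      by (intro sum.cong) (auto simp: canonical_C_def)
    also have "\<dots> = vec_index \<xi> (r - 1)" using r by (subst sum.delta) auto
    finally show ?thesis by simp
  qed
  have shift: "vec_index \<xi> i = vec_index \<xi> (i - 1)" if i: "i \<in> {1..<r}" for i
  proof -
    have "vec_index \<xi> i = (\<Sum>j<n. At $$ (i, j) *\<^sub>R vec_index \<xi> j)"
      using i r by (intro row) auto
    also have "\<dots> = (\<Sum>j<n. if j = i - 1 then vec_index \<xi> j else 0)"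
      using A i by (intro sum.cong) (auto simp: canonical_A_def)
    also have "\<dots> = vec_index \<xi> (i - 1)" using i r by (subst sum.delta) auto
    finally show ?thesis .
  qed
  have const: "vec_index \<xi> i = vec_index \<xi> 0" if "i < r" for i
    using that
  proof (induction i)
    case (Suc i) then show ?case using shift[of "Suc i"] by simp
  qed simp
  have \<xi>w: "vec_index \<xi> i = w" if "i < r" for i
    using const[OF that] const[of "r - 1"] last r by simp
  define x where "x = Matrix.vec ?N (\<lambda>i. if i < n then vec_index \<xi> i else if i < n + l then w else 0)"
  have x: "x \<in> carrier_vec ?N" by (simp add: x_def)
  have "vec_index (aug_A n r l At *\<^sub>k x) i = vec_index x i" if i: "i < ?N" for i
  proof -
    have Ax: "vec_index (aug_A n r l At *\<^sub>k x) i = (\<Sum>j<?N. aug_A n r l At $$ (i, j) *\<^sub>R vec_index x j)"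
      using i by (simp add: kron_mult_vec_index system_dims)
    show ?thesis
    proof (cases "i < n")
      case True
      have "(\<Sum>j<?N. aug_A n r l At $$ (i, j) *\<^sub>R vec_index x j)
          = (\<Sum>j<n. aug_A n r l At $$ (i, j) *\<^sub>R vec_index x j)"
        using True by (intro sum.mono_neutral_right) (auto simp: aug_A_state_row)
      also have "\<dots> = (\<Sum>j<n. At $$ (i, j) *\<^sub>R vec_index \<xi> j)"
        using True by (intro sum.cong) (auto simp: aug_A_state_row x_def)
      finally show ?thesis using Ax row[OF True] i True by (simp add: x_def)
    next
      case False
      \<comment> \<open>A filter row copies one block: the output into the head \<open>n\<close> of the first delay line, the
        preceding block elsewhere, and the input \<open>0\<close> into the head \<open>n + l\<close> of the second.\<close>
      then have "(\<Sum>j<?N. aug_A n r l At $$ (i, j) *\<^sub>R vec_index x j)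
          = (\<Sum>j<?N. if j = (if i = n then r - 1 else i - 1)
               then (if i \<noteq> n \<and> i = n + l then 0 else vec_index x j) else 0)"
        using i by (intro sum.cong) (auto simp: aug_A_filter_row)
      also have "\<dots> = (if i \<noteq> n \<and> i = n + l then 0 else vec_index x (if i = n then r - 1 else i - 1))"
        using i r False by (subst sum.delta) auto
      also have "\<dots> = vec_index x i"
        using i r False last by (auto simp: x_def)
      finally show ?thesis using Ax by simp
    qed
  qed
  then have "aug_A n r l At *\<^sub>k x + aug_B n l g *\<^sub>k single_block 0 - x = 0\<^sub>v ?N"
    using x by (intro eq_vecI) (simp_all add: kron_mult_vec_index[of _ "aug_B n l g"] system_dims)
  then have "defect n r l At g P x 0 = 0\<^sub>v ?N"
    unfolding defect_def by (intro eq_vecI) (simp_all add: kron_mult_vec_index system_dims)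
  then have defect: "vec_index (defect n r l At g P x 0) i = 0" if "i < ?N" for i
    using that by simp
  have xw: "vec_index x i = w" if "i < r" for i using \<xi>w that r by (simp add: x_def)
  have "stationary n r l At g P x 0"
    unfolding stationary_def using x defect xw r by simp
  moreover have "force n r l At g P x 0 = 0"
    unfolding force_def using defect r by simp
  ultimately show thesis using that[of x] xw r by simp
qed

end

section \<open>Gradients and the function class\<close>

lemma GDERIV_grad:
  fixes f :: "'v::euclidean_space \<Rightarrow> real"
  assumes "f differentiable (at x)"
  shows "GDERIV f x :> grad f x"
proof -
  obtain f' where f': "(f has_derivative f') (at x)" using assms by (auto simp: differentiable_def)
  then have lin: "linear f'" by (rule has_derivative_linear)
  have "f' = (\<lambda>h. inner h (adjoint f' 1))"
    using adjoint_works[OF lin, of _ 1] by auto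
  then have D: "GDERIV f x :> adjoint f' 1" using f' by (simp add: gderiv_def)
  have "D = D'" if "GDERIV f x :> D" "GDERIV f x :> D'" for D D'
  proof -
    have "(\<lambda>h. inner h D) = (\<lambda>h. inner h D')"
      using that unfolding gderiv_def by (rule has_derivative_unique)
    then show ?thesis by (metis vector_eq_ldot)
  qed
  then show ?thesis unfolding grad_def using D by (blast intro: theI)
qed

lemma grad_eqI:
  fixes f :: "'v::euclidean_space \<Rightarrow> real"
  assumes "GDERIV f x :> D"
  shows "grad f x = D"
proof -
  have "GDERIV f x :> grad f x"
    using assms by (intro GDERIV_grad) (auto simp: gderiv_def differentiable_def)
  then have "(\<lambda>h. inner h (grad f x)) = (\<lambda>h. inner h D)"
    using assms unfolding gderiv_def by (rule has_derivative_unique)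
  then show ?thesis by (metis vector_eq_ldot)
qed

text \<open>
  Test functions: for \<open>m \<noteq> 0\<close>, by the choice of \<open>c\<close>, the gradient at a given point takes any prescribed value.
\<close>

definition paraboloid :: "real \<Rightarrow> 'v::real_inner \<Rightarrow> 'v \<Rightarrow> real" where
  "paraboloid m c y = m / 2 * inner (y - c) (y - c)"

lemma GDERIV_paraboloid: "GDERIV (paraboloid m c) y :> m *\<^sub>R (y - c)"
  unfolding gderiv_def paraboloid_def[abs_def]
  by (auto intro!: derivative_eq_intros simp: inner_commute algebra_simps)

lemma grad_paraboloid: "grad (paraboloid m c) y = m *\<^sub>R (y - c)" for y :: "'v::euclidean_space"
  by (rule grad_eqI[OF GDERIV_paraboloid])

lemma paraboloid_in_S_class:
  fixes c :: "'v::euclidean_space"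
  assumes "m \<le> L"
  shows "paraboloid m c \<in> S_class m L"
proof -
  have "paraboloid m c differentiable (at x)" for x
    using GDERIV_paraboloid unfolding gderiv_def differentiable_def by blast
  moreover have "inner (m *\<^sub>R (x - c) - m *\<^sub>R (y - c)) (x - y) = m * (norm (x - y))\<^sup>2" for x y :: 'v
    by (simp add: scaleR_diff_right[symmetric] power2_norm_eq_inner)
  ultimately show ?thesis
    using assms by (auto simp: S_class_def grad_paraboloid intro: mult_right_mono)
qed

text \<open>
  By the mean value theorem on the segment from \<open>y\<close> to \<open>w\<close>, the increase of \<open>f\<close> is a slope at an
  interior point, and strong monotonicity of the gradient makes that slope exceed the one at \<open>y\<close>.
\<close>

lemma S_class_strictly_above_tangent:
  fixes f :: "'v::euclidean_space \<Rightarrow> real"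
  assumes f: "f \<in> S_class m L" and m: "0 < m" and ne: "w \<noteq> y"
  shows "inner (grad f y) (w - y) < f w - f y"
proof -
  let ?c = "\<lambda>t. y + t *\<^sub>R (w - y)"
  have deriv: "((\<lambda>t. f (?c t)) has_real_derivative inner (w - y) (grad f (?c t))) (at t)" for t :: real
  proof -
    have "(f has_derivative (\<lambda>h. inner h (grad f (?c t)))) (at (?c t))"
      using GDERIV_grad[of f "?c t"] f unfolding gderiv_def S_class_def by blast
    then have "((\<lambda>t. f (?c t)) has_derivative (\<lambda>s. inner (s *\<^sub>R (w - y)) (grad f (?c t)))) (at t)"
      by (rule has_derivative_compose[rotated]) (auto intro!: derivative_eq_intros)
    then show ?thesis
      by (simp add: has_field_derivative_def mult_commute_abs)
  qed
  obtain t where t: "0 < t" "t < 1" "f (?c 1) - f (?c 0) = (1 - 0) * inner (w - y) (grad f (?c t))"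
    using MVT2[of 0 1 "\<lambda>t. f (?c t)" "\<lambda>t. inner (w - y) (grad f (?c t))"] deriv by auto
  have "0 < m * (norm (?c t - y))\<^sup>2" using m t(1) ne by simp
  also have "\<dots> \<le> inner (grad f (?c t) - grad f y) (?c t - y)"
    using f unfolding S_class_def by blast
  also have "\<dots> = t * inner (grad f (?c t) - grad f y) (w - y)" by simp
  finally have "inner (grad f y) (w - y) < inner (grad f (?c t)) (w - y)"
    using t(1) by (simp add: zero_less_mult_iff inner_diff_left)
  then show ?thesis using t(3) by (simp add: inner_commute)
qed

lemma S_class_minimizer:
  fixes f :: "'v::euclidean_space \<Rightarrow> real"
  assumes f: "f \<in> S_class m L" and m: "0 < m"
    and y: "y \<in> \<Omega>" "\<And>w. w \<in> \<Omega> \<Longrightarrow> 0 \<le> inner (grad f y) (w - y)"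
  shows "{y. is_arg_min f (\<lambda>y. y \<in> \<Omega>) y} = {y}"
proof -
  have above: "f y < f w" if "w \<in> \<Omega>" "w \<noteq> y" for w
    using S_class_strictly_above_tangent[OF f m that(2)] y(2)[OF that(1)] by simp
  have "is_arg_min f (\<lambda>y. y \<in> \<Omega>) y"
    using above y(1) by (metis is_arg_min_linorder less_imp_le order_refl)
  moreover have "z = y" if "is_arg_min f (\<lambda>y. y \<in> \<Omega>) z" for z
    using that above y(1) by (auto simp: is_arg_min_def)
  ultimately show ?thesis by blast
qed

section \<open>The gain from gradient to force\<close>

text \<open>
  Everything is read off from unique fixed points of particular problems. With \<open>\<Omega> = {0}\<close> the
  variational inequality is void, so uniqueness says that the linear system with first block \<open>0\<close> has
  exactly one solution for each input \<open>u\<close>. Mapping the solution for a unit vector \<open>b\<close> blockwise by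
  \<open>v \<mapsto> \<langle>v, b\<rangle> u\<close> yields the solution for \<open>u\<close>, so its force is a fixed multiple \<open>\<kappa> u\<close>. Subtracting an
  equilibrium, which carries no force, extends this to an arbitrary first block.
  
  If \<open>\<kappa>\<close> were nonnegative, the fixed points would solve the variational inequality of \<open>-\<nabla>f\<close> (or no
  condition at all for \<open>\<kappa> = 0\<close>). For \<open>m/2 |y|\<^sup>2\<close> on the segment from \<open>-b\<close> to \<open>b\<close> this has the two
  solutions \<open>0\<close> and \<open>b\<close>, contradicting uniqueness.
\<close>

lemma force_negative_gain:
  fixes m L :: real
  assumes mL: "0 < m" "m \<le> L"
    and A: "canonical_A n r At" and r: "1 \<le> r" "r \<le> n"
    and equilibrium: "\<And>y::'v::euclidean_space. \<exists>\<xi>. \<xi> \<in> carrier_vec n \<and>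
          At *\<^sub>k \<xi> = \<xi> \<and> canonical_C n r *\<^sub>k \<xi> = single_block y"
    and P: "P \<in> carrier_mat (n + 2 * l) (n + 2 * l)" and pd: "kron_pos_def TYPE('v) P"
    and unique: "\<And>(h::'v \<Rightarrow> real) W. h \<in> S_class m L \<Longrightarrow> W \<noteq> {} \<Longrightarrow> closed W \<Longrightarrow> convex W
          \<Longrightarrow> \<exists>!x. fixed_point n r l At g P h W x"
  obtains \<kappa> where "\<kappa> < 0"
    "\<And>(x::'v vec) u. stationary n r l At g P x u \<Longrightarrow> force n r l At g P x u = \<kappa> *\<^sub>R u"
proof -
  let ?S = "stationary n r l At g P" and ?F = "force n r l At g P"
  note diff = stationary_diff[OF A r P] and map = stationary_map[OF A r P]
  have fp: "fixed_point n r l At g P f W x \<longleftrightarrow> ?S x (grad f (vec_index x 0)) \<and> vec_index x 0 \<in> W \<and>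
      (\<forall>w\<in>W. inner (w - vec_index x 0) (?F x (grad f (vec_index x 0))) \<le> 0)"
    if "W \<noteq> {}" "closed W" "convex W" for W f and x :: "'v vec"
    by (rule fixed_point_iff_stationary[OF A r P pd that])
  \<comment> \<open>On \<open>\<Omega> = {0}\<close>, the paraboloid centred at \<open>- u / m\<close> has gradient \<open>u\<close> at the only feasible point.\<close>
  have ex1: "\<exists>!x. ?S x u \<and> vec_index x 0 = 0" for u :: 'v
  proof -
    let ?c = "- (1 / m) *\<^sub>R u"
    have "fixed_point n r l At g P (paraboloid m ?c) {0} x \<longleftrightarrow> ?S x u \<and> vec_index x 0 = 0" for x
      using fp[of "{0}" "paraboloid m ?c" x] mL(1) by (auto simp: grad_paraboloid)
    then show ?thesis using unique[OF paraboloid_in_S_class[OF mL(2), of ?c], of "{0}"] by simp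
  qed
  have equi: "\<exists>x. ?S x 0 \<and> vec_index x 0 = w \<and> ?F x 0 = 0" for w :: 'v
    using equilibrium[of w] equilibrium_state[OF A r P] by metis
  obtain b :: 'v where b: "norm b = 1" using vector_choose_size[of 1] by auto
  obtain xb where xb: "?S xb b" "vec_index xb 0 = 0" using ex1[of b] by blast
  define \<kappa> where "\<kappa> = inner (?F xb b) b"
  have lift: "?S (map_vec (\<lambda>v. inner v b *\<^sub>R u) xb) u
      \<and> vec_index (map_vec (\<lambda>v. inner v b *\<^sub>R u) xb) 0 = 0
      \<and> ?F (map_vec (\<lambda>v. inner v b *\<^sub>R u) xb) u = \<kappa> *\<^sub>R u" for u
  proof -
    have lin: "linear (\<lambda>v. inner v b *\<^sub>R u)"
      by (rule linearI) (simp_all add: inner_add_left scaleR_add_left)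
    have "inner b b *\<^sub>R u = u" using b by (simp add: norm_eq_1)
    then show ?thesis using map[OF lin xb(1)] xb(2) by (simp add: \<kappa>_def)
  qed
  have gain: "?F x u = \<kappa> *\<^sub>R u" if x: "?S x u" for x :: "'v vec" and u
  proof -
    obtain e where e: "?S e 0" "vec_index e 0 = vec_index x 0" "?F e 0 = 0"
      using equi by blast
    have "?S (x - e) u" "vec_index (x - e) 0 = 0" "?F (x - e) u = ?F x u"
      using diff[OF x e(1)] e by simp_all
    then show ?thesis using ex1[of u] lift[of u] by metis
  qed
  have "\<kappa> < 0"
  proof (rule ccontr)
    assume "\<not> \<kappa> < 0"
    let ?W = "closed_segment (- b) b"
    have W: "?W \<noteq> {}" "closed ?W" "convex ?W" by (auto simp: closed_segment)
    have fixed: "\<exists>x. fixed_point n r l At g P (paraboloid m 0) ?W x \<and> vec_index x 0 = y"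
      if y: "y \<in> {0, b}" for y
    proof -
      obtain e where e: "?S e 0" "vec_index e 0 = y" using equi by blast
      \<comment> \<open>The gradient of the paraboloid at \<open>y\<close> is \<open>m y\<close>; \<open>e - z\<close> is the state with this input and output \<open>y\<close>.\<close>
      obtain z where z: "?S z (- (m *\<^sub>R y))" "vec_index z 0 = 0" using ex1 by blast
      have x: "?S (e - z) (m *\<^sub>R y)" "vec_index (e - z) 0 = y"
        using diff[OF e(1) z(1)] e z by simp_all
      have "inner (w - y) (?F (e - z) (m *\<^sub>R y)) \<le> 0" if w: "w \<in> ?W" for w
      proof -
        obtain t where t: "0 \<le> t" "t \<le> 1" "w = (1 - t) *\<^sub>R (- b) + t *\<^sub>R b"
          using w by (auto simp: closed_segment_def)
        have "inner (w - b) b = 2 * t - 2"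
          using b by (simp add: t(3) norm_eq_1 algebra_simps)
        then have "inner (w - b) b \<le> 0" using t by simp
        then have "\<kappa> * m * inner (w - b) b \<le> 0"
          using \<open>\<not> \<kappa> < 0\<close> mL(1) by (intro mult_nonneg_nonpos) auto
        then show ?thesis using y gain[OF x(1)] by (auto simp: mult.assoc)
      qed
      moreover have "0 \<in> ?W"
        unfolding closed_segment_def by (intro CollectI exI[of _ "1 / 2"]) simp
      moreover have "b \<in> ?W" by simp
      ultimately have "fixed_point n r l At g P (paraboloid m 0) ?W (e - z)"
        using fp[OF W, of "paraboloid m 0" "e - z"] x y unfolding grad_paraboloid by auto
      then show ?thesis using x(2) by blast
    qed
    have "b \<noteq> 0" using b by auto
    then show False
      using unique[OF paraboloid_in_S_class[OF mL(2), of 0] W] fixed[of 0] fixed[of b] by auto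
  qed
  then show thesis using gain that by blast
qed

section \<open>Fixed points are minimizers\<close>

theorem theorem3:
  fixes n r l :: nat and m L g :: real and At P :: "real mat"
    and f :: "real ^ 'd \<Rightarrow> real" and \<Omega> :: "(real ^ 'd) set"
    and ystar :: "real ^ 'd" and ybold eta :: "(real ^ 'd) Matrix.vec"
  assumes mL: "0 < m" "m \<le> L"
    and dims: "1 \<le> r" "r \<le> n"
    and At: "canonical_A n r At"
    and g: "g < 0"
    and detect: "detectable TYPE(real ^ 'd) At (canonical_C n r)"
    and eig: "eigenvalue_one TYPE(real ^ 'd) At"
    and equilibrium: "\<forall>y :: real ^ 'd. \<exists>!\<xi>. \<xi> \<in> carrier_vec n \<and>
          At *\<^sub>k \<xi> = \<xi> \<and> canonical_C n r *\<^sub>k \<xi> = single_block y"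
    and P: "lyapunov_matrix TYPE(real ^ 'd) m L n r l At g P"
    and unique_fixed_point:
      "\<forall>h \<in> (S_class m L :: (real ^ 'd \<Rightarrow> real) set). \<forall>W :: (real ^ 'd) set.
         W \<noteq> {} \<and> closed W \<and> convex W \<longrightarrow> (\<exists>!x. fixed_point n r l At g P h W x)"
    and f: "f \<in> S_class m L"
    and \<Omega>: "\<Omega> \<noteq> {}" "closed \<Omega>" "convex \<Omega>"
    and partition: "ybold \<in> carrier_vec (r - 1)" "eta \<in> carrier_vec (n + 2 * l - r)"
    and xstar: "fixed_point n r l At g P f \<Omega> (vCons ystar (ybold @\<^sub>v eta))"
  shows "{y. is_arg_min f (\<lambda>y. y \<in> \<Omega>) y} = {ystar}"
proof -
  let ?x = "vCons ystar (ybold @\<^sub>v eta)"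
  have Pc: "P \<in> carrier_mat (n + 2 * l) (n + 2 * l)" and pd: "kron_pos_def TYPE(real ^ 'd) P"
    using P by (auto simp: lyapunov_matrix_def)
  obtain \<kappa> where \<kappa>: "\<kappa> < 0"
    and gain: "\<And>(x::(real ^ 'd) Matrix.vec) u. stationary n r l At g P x u
      \<Longrightarrow> force n r l At g P x u = \<kappa> *\<^sub>R u"
  proof (rule force_negative_gain[OF mL At dims _ Pc pd])
    show "\<exists>\<xi>. \<xi> \<in> carrier_vec n \<and> At *\<^sub>k \<xi> = \<xi> \<and> canonical_C n r *\<^sub>k \<xi> = single_block y"
      for y :: "real ^ 'd"
      using equilibrium by blast
    show "\<exists>!x. fixed_point n r l At g P h W x"
      if "h \<in> S_class m L" "W \<noteq> {}" "closed W" "convex W" for h and W :: "(real ^ 'd) set"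
      using unique_fixed_point that by blast
  qed blast
  have x: "stationary n r l At g P ?x (grad f ystar)" "ystar \<in> \<Omega>"
    "\<And>w. w \<in> \<Omega> \<Longrightarrow> inner (w - ystar) (force n r l At g P ?x (grad f ystar)) \<le> 0"
    using xstar unfolding fixed_point_iff_stationary[OF At dims Pc pd \<Omega>] by auto
  have "0 \<le> inner (grad f ystar) (w - ystar)" if "w \<in> \<Omega>" for w
    using x(3)[OF that] \<kappa> unfolding gain[OF x(1)]
    by (simp add: mult_le_0_iff inner_commute)
  then show ?thesis using S_class_minimizer[OF f mL(1) x(2)] by blast
qed

end
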